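(* Let $\Pi$ be a pure formula, $\Sigma$ a spatial formula, $I$ a finite linearly ordered index set, and for each $i\in I$ let $\Pi_i$ be a pure formula, $\Sigma_i$ a spatial formula and $\overrightarrow{y_i}$ a sequence of variables. Let $\overrightarrow y$ be the concatenation of the $\overrightarrow{y_i}$ ($i\in I$), and let $\overrightarrow z$ be the set of variables in ${\rm FV}(P(\Pi,\Sigma,\{(\Pi_i,\Sigma_i)\}_{i\in I}))$ that do not occur free in $\Pi$, $\Sigma$, $\Pi_i$, $\Sigma_i$ ($i\in I$) (i.e. the fresh variables introduced while computing $P$). Suppose that every array atomic formula occurring in each $\Sigma_i$ has the form ${\rm Arr}(t,t+u)$ where the term $u$ contains no variable of $\overrightarrow y$. Then \[ \Pi\land\widetilde\Sigma \models \bigvee_{i\in I}\exists \overrightarrow{y_i}(\Pi_i\land\widetilde{\Sigma_i}) \quad\text{iff}\quad \models \forall \overrightarrow z\,\exists \overrightarrow y\, P(\Pi,\Sigma,\{(\Pi_i,\Sigma_i)\}_{i\in I}). \]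
   Context: Terms: $t::=x\mid 0\mid 1\mid 2\mid\cdots\mid t+t$ ($x$ a variable). Pure formulas are first-order formulas of Presburger arithmetic over these terms (built from $t=t$, $\land$, $\neg$, $\exists$; $t\le u$ abbreviates $\exists x(u=t+x)$, $t<u$ abbreviates $t+1\le u$, ${\rm true}$ is $0=0$). Spatial formulas: $\Sigma::={\rm emp}\mid t\mapsto t\mid {\rm Arr}(t,t)\mid \Sigma*\Sigma$; a spatial formula is regarded as a list of atoms ${\rm emp}$, $t\mapsto u$, ${\rm Arr}(t,u)$ with $*$ as list constructor and ${\rm emp}$ also denoting the empty list; the first atom is the head. Semantics: values are $\mathbb N$, locations are $\mathbb N\setminus\{0\}$, a store $s$ maps variables to $\mathbb N$ (extended to terms by $s(n)=n$, $s(t+u)=s(t)+s(u)$), a heap $h$ is a finite partial function from locations to $\mathbb N$. Pure formulas are interpreted in $s$ as usual (independently of $h$). $s,h\models{\rm emp}$ iff ${\rm Dom}(h)=\emptyset$; $s,h\models t\mapsto u$ iff ${\rm Dom}(h)=\{s(t)\}$ and $h(s(t))=s(u)$; $s,h\models{\rm Arr}(t,u)$ iff $s(t)\le s(u)$ and ${\rm Dom}(h)=\{x\mid s(t)\le x\le s(u)\}$; $s,h\models\varphi_1*\varphi_2$ iff $h=h_1+h_2$ (disjoint union) with $s,h_1\models\varphi_1$, $s,h_2\models\varphi_2$; connectives and $\exists$ as usual. $\varphi\models\psi$ means every $(s,h)$ satisfying $\varphi$ satisfies $\psi$; $\models\varphi$ means $\varphi$ holds in all $(s,h)$. Sortedness: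 $t<{\rm emp}:={\rm true}$; $t<({\rm emp}*\Sigma_1):=t<\Sigma_1$; $t<(t_1\mapsto u_1*\Sigma_1):=t<t_1$; $t<({\rm Arr}(t_1,u_1)*\Sigma_1):=t<t_1$. ${\rm Sorted}'({\rm emp}):={\rm true}$; ${\rm Sorted}'({\rm emp}*\Sigma_1):={\rm Sorted}'(\Sigma_1)$; ${\rm Sorted}'(t\mapsto u*\Sigma_1):=t<\Sigma_1\land{\rm Sorted}'(\Sigma_1)$; ${\rm Sorted}'({\rm Arr}(t,u)*\Sigma_1):=t\le u\land u<\Sigma_1\land{\rm Sorted}'(\Sigma_1)$; ${\rm Sorted}(\Sigma):=0<\Sigma\land{\rm Sorted}'(\Sigma)$. $\widetilde\Sigma$ denotes ${\rm Sorted}(\Sigma)\land\Sigma$. The translation $P(\Pi,\Sigma,S)$, where $S=\{(\Pi_i,\Sigma_i)\}_{i\in I}$ is a finite set of pairs (pure, spatial), is defined by the following clauses, the first matching clause (top to bottom) being used. Notation: $u=t_J$ means $\bigwedge_{j\in J}u=t_j$, and $u<t_J$ means $\bigwedge_{j\in J}u<t_j$. (EmpL) $P(\Pi,{\rm emp}*\Sigma,S)=P(\Pi,\Sigma,S)$. (EmpR) $P(\Pi,\Sigma,\{(\Pi',{\rm emp}*\Sigma')\}\cup S)=P(\Pi,\Sigma,\{(\Pi',\Sigma')\}\cup S)$. (EmpNEmp) $P(\Pi,{\rm emp},\{(\Pi',\Sigma')\}\cup S)=P(\Pi,{\rm emp},S)$ if $\Sigma'\not\equiv{\rm emp}$. (EmpEmp)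 $P(\Pi,{\rm emp},\{(\Pi_i,{\rm emp})\}_{i\in I})=\Pi\to\bigvee_{i\in I}\Pi_i$. (NEmpEmp) $P(\Pi,\Sigma,\{(\Pi',{\rm emp})\}\cup S)=P(\Pi,\Sigma,S)$ if $\Sigma\not\equiv{\rm emp}$. (empty) $P(\Pi,\Sigma,\emptyset)=\neg(\Pi\land{\rm Sorted}(\Sigma))$. ($\mapsto\mapsto$) $P(\Pi,t\mapsto u*\Sigma,\{(\Pi_i,t_i\mapsto u_i*\Sigma_i)\}_{i\in I})=P(\Pi\land t<\Sigma,\Sigma,\{(\Pi_i\land t=t_i\land u=u_i\land t_i<\Sigma_i,\Sigma_i)\}_{i\in I})$. ($\mapsto$Arr) $P(\Pi,t\mapsto u*\Sigma,\{(\Pi_i,{\rm Arr}(t_i,t_i')*\Sigma_i)\}\cup S)=P(\Pi\land t_i'=t_i,t\mapsto u*\Sigma,\{(\Pi_i,t_i\mapsto u*\Sigma_i)\}\cup S)\land P(\Pi\land t_i'>t_i,t\mapsto u*\Sigma,\{(\Pi_i,t_i\mapsto u*{\rm Arr}(t_i+1,t_i')*\Sigma_i)\}\cup S)\land P(\Pi\land t_i'<t_i,t\mapsto u*\Sigma,S)$. (Arr$\mapsto$) if some element of $S$ has the form $(\Pi'',t''\mapsto u''*\Sigma'')$: $P(\Pi,{\rm Arr}(t,t')*\Sigma,S)=P(\Pi\land t'>t,t\mapsto z*{\rm Arr}(t+1,t')*\Sigma,S)\land P(\Pi\land t'=t,t\mapsto z'*\Sigma,S)$ with $z,z'$ fresh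 variables. (ArrArr) $P(\Pi,{\rm Arr}(t,t')*\Sigma,\{(\Pi_i,{\rm Arr}(t_i,t_i')*\Sigma_i)\}_{i\in I})=\bigwedge_{I'\subseteq I}P\big(\Pi\land m=m_{I'}\land m<m_{I\setminus I'}\land t\le t'\land t'<\Sigma,\ \Sigma,\ \{(\Pi_i\land t_i+m<\Sigma_i,\Sigma_i)\}_{i\in I'}\cup\{(\Pi_i,{\rm Arr}(t_i+m+1,t_i')*\Sigma_i)\}_{i\in I\setminus I'}\big)\land\bigwedge_{\emptyset\ne I'\subseteq I}P\big(\Pi\land m'<m\land m'=m_{I'}\land m'<m_{I\setminus I'},\ {\rm Arr}(t+m'+1,t')*\Sigma,\ \{(\Pi_i\land t_i+m'<\Sigma_i,\Sigma_i)\}_{i\in I'}\cup\{(\Pi_i,{\rm Arr}(t_i+m'+1,t_i')*\Sigma_i)\}_{i\in I\setminus I'}\big)$, where $m$, $m_i$, $m'$ abbreviate $t'-t$, $t_i'-t_i$, $m_{\min I'}$ respectively. During the computation terms may contain differences $u-t$; in the resulting formula these are eliminated by rewriting atoms, e.g. $t'+(u-t)=t''$ into $t'+u=t''+t$ and $t'+(u-t)<t''$ into $t'+u<t''+t$, so the result is a Presburger formula.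
   Formalization: In (ArrArr) the conjunct t=t_i is added to every pair of the new families; the computation of P starts with Π∧0<Σ in place of Π; and no variable of y may occur free in either side of the entailment. Without each of these the equivalence fails. *)

theory Defs
  imports Main
begin

text \<open>
  Variables are natural numbers. Two kinds of terms occur: the terms \<open>tm\<close> of the assertion
  language, and the terms \<open>dtm\<close> that may contain differences and only live inside the
  computation of the translation. The class gives both the operations that pure formulas need,
  so that order atoms and sortedness are defined once.
\<close>

class arith_term =
  fixes var :: "nat \<Rightarrow> 'a"
    and num :: "nat \<Rightarrow> 'a"
    and add :: "'a \<Rightarrow> 'a \<Rightarrow> 'a"  (infixl "\<oplus>" 65)
    and vars :: "'a \<Rightarrow> nat set"

datatype tm = Var nat | Num nat | Add tm tm

datatype dtm = Tm tm | DAdd dtm dtm | DSub dtm dtm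

instantiation tm :: arith_term
begin

definition "var = Var"
definition "num = Num"
definition "add = Add"

primrec vars_tm :: "tm \<Rightarrow> nat set" where
  "vars_tm (Var x) = {x}"
| "vars_tm (Num n) = {}"
| "vars_tm (Add t u) = vars_tm t \<union> vars_tm u"

instance ..

end

instantiation dtm :: arith_term
begin

definition "var x = Tm (Var x)"
definition "num n = Tm (Num n)"
definition "add = DAdd"

primrec vars_dtm :: "dtm \<Rightarrow> nat set" where
  "vars_dtm (Tm t) = vars t"
| "vars_dtm (DAdd t u) = vars_dtm t \<union> vars_dtm u"
| "vars_dtm (DSub t u) = vars_dtm t \<union> vars_dtm u"

instance ..

end

datatype 'a pure = PEq 'a 'a | PAnd "'a pure" "'a pure" | PNot "'a pure" | PEx nat "'a pure"

primrec fv_pure :: "'a::arith_term pure \<Rightarrow> nat set" where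
  "fv_pure (PEq t u) = vars t \<union> vars u"
| "fv_pure (PAnd p q) = fv_pure p \<union> fv_pure q"
| "fv_pure (PNot p) = fv_pure p"
| "fv_pure (PEx x p) = fv_pure p - {x}"

definition PTrue :: "'a::arith_term pure" where
  "PTrue = PEq (num 0) (num 0)"

definition POr :: "'a pure \<Rightarrow> 'a pure \<Rightarrow> 'a pure" where
  "POr p q = PNot (PAnd (PNot p) (PNot q))"

definition PImp :: "'a pure \<Rightarrow> 'a pure \<Rightarrow> 'a pure" where
  "PImp p q = PNot (PAnd p (PNot q))"

definition PAll :: "nat \<Rightarrow> 'a pure \<Rightarrow> 'a pure" where
  "PAll x p = PNot (PEx x (PNot p))"

definition PConj :: "'a::arith_term pure list \<Rightarrow> 'a pure" where
  "PConj ps = foldr PAnd ps PTrue"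

definition PDisj :: "'a::arith_term pure list \<Rightarrow> 'a pure" where
  "PDisj ps = foldr POr ps (PNot PTrue)"

text \<open>The bound variable of \<open>t \<le> u\<close> has to be chosen outside \<open>t\<close> and \<open>u\<close>.\<close>

definition PLe :: "'a::arith_term \<Rightarrow> 'a \<Rightarrow> 'a pure" where
  "PLe t u = (let x = Suc (Max (insert 0 (vars t \<union> vars u))) in PEx x (PEq u (t \<oplus> var x)))"

definition PLt :: "'a::arith_term \<Rightarrow> 'a \<Rightarrow> 'a pure" where
  "PLt t u = PLe (t \<oplus> num 1) u"

datatype 'a atom = Emp | PointsTo (addr: 'a) (cont: 'a) | Arr (lo: 'a) (hi: 'a)

type_synonym 'a spatial = "'a atom list"

definition fv_spatial :: "'a::arith_term spatial \<Rightarrow> nat set" where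
  "fv_spatial \<Sigma> = (\<Union>a\<in>set \<Sigma>. \<Union>t\<in>set_atom a. vars t)"

fun below :: "'a::arith_term \<Rightarrow> 'a spatial \<Rightarrow> 'a pure" where
  "below t [] = PTrue"
| "below t (Emp # \<Sigma>) = below t \<Sigma>"
| "below t (PointsTo t1 u1 # \<Sigma>) = PLt t t1"
| "below t (Arr t1 u1 # \<Sigma>) = PLt t t1"

fun sorted' :: "'a::arith_term spatial \<Rightarrow> 'a pure" where
  "sorted' [] = PTrue"
| "sorted' (Emp # \<Sigma>) = sorted' \<Sigma>"
| "sorted' (PointsTo t u # \<Sigma>) = PAnd (below t \<Sigma>) (sorted' \<Sigma>)"
| "sorted' (Arr t u # \<Sigma>) = PAnd (PLe t u) (PAnd (below u \<Sigma>) (sorted' \<Sigma>))"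

definition sorted_sp :: "'a::arith_term spatial \<Rightarrow> 'a pure" where
  "sorted_sp \<Sigma> = PAnd (below (num 0) \<Sigma>) (sorted' \<Sigma>)"

type_synonym store = "nat \<Rightarrow> nat"
type_synonym heap = "nat \<rightharpoonup> nat"

definition is_heap :: "heap \<Rightarrow> bool" where
  "is_heap h \<longleftrightarrow> finite (dom h) \<and> 0 \<notin> dom h"

primrec val :: "store \<Rightarrow> tm \<Rightarrow> nat" where
  "val s (Var x) = s x"
| "val s (Num n) = n"
| "val s (Add t u) = val s t + val s u"

primrec sat_pure :: "store \<Rightarrow> tm pure \<Rightarrow> bool" where
  "sat_pure s (PEq t u) \<longleftrightarrow> val s t = val s u"
| "sat_pure s (PAnd p q) \<longleftrightarrow> sat_pure s p \<and> sat_pure s q"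
| "sat_pure s (PNot p) \<longleftrightarrow> \<not> sat_pure s p"
| "sat_pure s (PEx x p) \<longleftrightarrow> (\<exists>n. sat_pure (s(x := n)) p)"

primrec sat_atom :: "store \<Rightarrow> heap \<Rightarrow> tm atom \<Rightarrow> bool" where
  "sat_atom s h Emp \<longleftrightarrow> dom h = {}"
| "sat_atom s h (PointsTo t u) \<longleftrightarrow> dom h = {val s t} \<and> h (val s t) = Some (val s u)"
| "sat_atom s h (Arr t u) \<longleftrightarrow> val s t \<le> val s u \<and> dom h = {val s t..val s u}"

primrec sat_spatial :: "store \<Rightarrow> heap \<Rightarrow> tm spatial \<Rightarrow> bool" where
  "sat_spatial s h [] \<longleftrightarrow> dom h = {}"
| "sat_spatial s h (a # \<Sigma>) \<longleftrightarrow>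
     (\<exists>h1 h2. dom h1 \<inter> dom h2 = {} \<and> h = h1 ++ h2 \<and> sat_atom s h1 a \<and> sat_spatial s h2 \<Sigma>)"

datatype form = Pure "tm pure" | Spatial "tm spatial" | FAnd form form | FNot form | FEx nat form

primrec sat :: "store \<Rightarrow> heap \<Rightarrow> form \<Rightarrow> bool" where
  "sat s h (Pure p) \<longleftrightarrow> sat_pure s p"
| "sat s h (Spatial \<Sigma>) \<longleftrightarrow> sat_spatial s h \<Sigma>"
| "sat s h (FAnd f g) \<longleftrightarrow> sat s h f \<and> sat s h g"
| "sat s h (FNot f) \<longleftrightarrow> \<not> sat s h f"
| "sat s h (FEx x f) \<longleftrightarrow> (\<exists>n. sat (s(x := n)) h f)"

primrec fv :: "form \<Rightarrow> nat set" where
  "fv (Pure p) = fv_pure p"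
| "fv (Spatial \<Sigma>) = fv_spatial \<Sigma>"
| "fv (FAnd f g) = fv f \<union> fv g"
| "fv (FNot f) = fv f"
| "fv (FEx x f) = fv f - {x}"

definition FOr :: "form \<Rightarrow> form \<Rightarrow> form" where
  "FOr f g = FNot (FAnd (FNot f) (FNot g))"

definition FDisj :: "form list \<Rightarrow> form" where
  "FDisj fs = foldr FOr fs (FNot (Pure PTrue))"

definition entails :: "form \<Rightarrow> form \<Rightarrow> bool"  (infix "\<TTurnstile>" 50) where
  "f \<TTurnstile> g \<longleftrightarrow> (\<forall>s h. is_heap h \<longrightarrow> sat s h f \<longrightarrow> sat s h g)"

definition valid :: "form \<Rightarrow> bool" where
  "valid f \<longleftrightarrow> (\<forall>s h. is_heap h \<longrightarrow> sat s h f)"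

definition tilde :: "tm spatial \<Rightarrow> form" where
  "tilde \<Sigma> = FAnd (Pure (sorted_sp \<Sigma>)) (Spatial \<Sigma>)"

type_synonym 'a family = "('a pure \<times> 'a spatial) list"

fun head_emp :: "'a pure \<times> 'a spatial \<Rightarrow> bool" where
  "head_emp (_, Emp # _) = True"
| "head_emp _ = False"

fun head_pt :: "'a pure \<times> 'a spatial \<Rightarrow> bool" where
  "head_pt (_, PointsTo _ _ # _) = True"
| "head_pt _ = False"

fun head_arr :: "'a pure \<times> 'a spatial \<Rightarrow> bool" where
  "head_arr (_, Arr _ _ # _) = True"
| "head_arr _ = False"

definition match_pt :: "dtm \<Rightarrow> dtm \<Rightarrow> dtm pure \<times> dtm spatial \<Rightarrow> dtm pure \<times> dtm spatial" where
  "match_pt t u = (\<lambda>(\<Pi>i, \<Sigma>i).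
     let ti = addr (hd \<Sigma>i); ui = cont (hd \<Sigma>i)
     in (PConj [\<Pi>i, PEq t ti, PEq u ui, below ti (tl \<Sigma>i)], tl \<Sigma>i))"

definition arr_len :: "dtm pure \<times> dtm spatial \<Rightarrow> dtm" where
  "arr_len e = (let a = hd (snd e) in DSub (hi a) (lo a))"

text \<open>
  All heads of \<open>S\<close> are arrays. Those at the positions in \<open>J\<close> have length \<open>m\<close> and are removed;
  from the others an initial part of that length is cut off. The equation \<open>t = t\<^sub>i\<close> fixes the
  starting address of the part that is cut off. The printed clause for two arrays does not
  contain it; without it arrays would be compared by length only, and \<open>Arr(1,2)\<close> would be
  found to entail \<open>Arr(5,6)\<close>.
\<close>

definition cut_arr :: "nat list \<Rightarrow> dtm \<Rightarrow> dtm \<Rightarrow> dtm family \<Rightarrow> dtm family" where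
  "cut_arr J t m S = map (\<lambda>i.
     let (\<Pi>i, \<Sigma>i) = S ! i; ti = lo (hd \<Sigma>i); ti' = hi (hd \<Sigma>i) in
     if i \<in> set J
     then (PConj [\<Pi>i, PEq t ti, below (ti \<oplus> m) (tl \<Sigma>i)], tl \<Sigma>i)
     else (PAnd \<Pi>i (PEq t ti), Arr (ti \<oplus> m \<oplus> num 1) ti' # tl \<Sigma>i)) [0..<length S]"

text \<open>The conditions \<open>m = m\<^sub>J\<close> and \<open>m < m\<^sub>K\<close>, where \<open>K\<close> is the complement of \<open>J\<close>.\<close>

definition shortest :: "nat list \<Rightarrow> dtm \<Rightarrow> dtm family \<Rightarrow> dtm pure" where
  "shortest J m S = PAnd
     (PConj (map (\<lambda>j. PEq m (arr_len (S ! j))) J))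
     (PConj (map (\<lambda>j. PLt m (arr_len (S ! j))) (filter (\<lambda>j. j \<notin> set J) [0..<length S])))"

text \<open>
  \<open>\<nu>\<close> chooses fresh variables and \<open>X\<close> collects the variables that are already in use.
  \<open>List.extract\<close> splits a list at its first element with the given property.
  The subsets of the index set are the sublists of \<open>[0..<length S]\<close>, so that the least
  element of a nonempty one is its head.
\<close>

function transl ::
  "(nat set \<Rightarrow> nat) \<Rightarrow> nat set \<Rightarrow> dtm pure \<Rightarrow> dtm spatial \<Rightarrow> dtm family \<Rightarrow> dtm pure" where
  "transl \<nu> X \<Pi> (Emp # \<Sigma>) S = transl \<nu> X \<Pi> \<Sigma> S"
| "transl \<nu> X \<Pi> [] S =
    (case List.extract head_emp S of
       Some (S1, (\<Pi>', \<Sigma>'), S2) \<Rightarrow> transl \<nu> X \<Pi> [] (S1 @ (\<Pi>', tl \<Sigma>') # S2)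
     | None \<Rightarrow>
    (case List.extract (\<lambda>(\<Pi>', \<Sigma>'). \<Sigma>' \<noteq> []) S of
       Some (S1, _, S2) \<Rightarrow> transl \<nu> X \<Pi> [] (S1 @ S2)
     | None \<Rightarrow> PImp \<Pi> (PDisj (map fst S))))"
| "transl \<nu> X \<Pi> (PointsTo t u # \<Sigma>) S =
    (case List.extract head_emp S of
       Some (S1, (\<Pi>', \<Sigma>'), S2) \<Rightarrow>
         transl \<nu> X \<Pi> (PointsTo t u # \<Sigma>) (S1 @ (\<Pi>', tl \<Sigma>') # S2)
     | None \<Rightarrow>
    (case List.extract (\<lambda>(\<Pi>', \<Sigma>'). \<Sigma>' = []) S of
       Some (S1, _, S2) \<Rightarrow> transl \<nu> X \<Pi> (PointsTo t u # \<Sigma>) (S1 @ S2)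
     | None \<Rightarrow>
     if S = [] then PNot (PAnd \<Pi> (sorted_sp (PointsTo t u # \<Sigma>)))
     else
    (case List.extract head_arr S of
       None \<Rightarrow> transl \<nu> X (PAnd \<Pi> (below t \<Sigma>)) \<Sigma> (map (match_pt t u) S)
     | Some (S1, (\<Pi>i, \<Sigma>i), S2) \<Rightarrow>
         let ti = lo (hd \<Sigma>i); ti' = hi (hd \<Sigma>i) in
         PConj
          [transl \<nu> X (PAnd \<Pi> (PEq ti' ti)) (PointsTo t u # \<Sigma>)
             (S1 @ (\<Pi>i, PointsTo ti u # tl \<Sigma>i) # S2),
           transl \<nu> X (PAnd \<Pi> (PLt ti ti')) (PointsTo t u # \<Sigma>)
             (S1 @ (\<Pi>i, PointsTo ti u # Arr (ti \<oplus> num 1) ti' # tl \<Sigma>i) # S2),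
           transl \<nu> X (PAnd \<Pi> (PLt ti' ti)) (PointsTo t u # \<Sigma>) (S1 @ S2)])))"
| "transl \<nu> X \<Pi> (Arr t t' # \<Sigma>) S =
    (case List.extract head_emp S of
       Some (S1, (\<Pi>', \<Sigma>'), S2) \<Rightarrow>
         transl \<nu> X \<Pi> (Arr t t' # \<Sigma>) (S1 @ (\<Pi>', tl \<Sigma>') # S2)
     | None \<Rightarrow>
    (case List.extract (\<lambda>(\<Pi>', \<Sigma>'). \<Sigma>' = []) S of
       Some (S1, _, S2) \<Rightarrow> transl \<nu> X \<Pi> (Arr t t' # \<Sigma>) (S1 @ S2)
     | None \<Rightarrow>
     if S = [] then PNot (PAnd \<Pi> (sorted_sp (Arr t t' # \<Sigma>)))
     else if \<exists>e\<in>set S. head_pt e then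
       let z = \<nu> X; z' = \<nu> (insert z X); X' = insert z' (insert z X) in
       PAnd
        (transl \<nu> X' (PAnd \<Pi> (PLt t t')) (PointsTo t (var z) # Arr (t \<oplus> num 1) t' # \<Sigma>) S)
        (transl \<nu> X' (PAnd \<Pi> (PEq t' t)) (PointsTo t (var z') # \<Sigma>) S)
     else
       let m = DSub t' t in
       PAnd
        (PConj (map (\<lambda>J.
            transl \<nu> X (PConj [\<Pi>, shortest J m S, PLe t t', below t' \<Sigma>]) \<Sigma> (cut_arr J t m S))
          (subseqs [0..<length S])))
        (PConj (map (\<lambda>J.
            let m' = arr_len (S ! hd J) in
            transl \<nu> X (PConj [\<Pi>, PLt m' m, shortest J m' S])
              (Arr (t \<oplus> m' \<oplus> num 1) t' # \<Sigma>) (cut_arr J t m' S))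
          (filter (\<lambda>J. J \<noteq> []) (subseqs [0..<length S]))))))"
  by pat_completeness auto

text \<open>
  Termination. With a points-to head of \<open>\<Sigma>\<close>, splitting an array head of \<open>S\<close> adds an atom that the
  matching of the heads removes again; the first component discounts these atoms in advance.
\<close>

definition fam_size :: "'a family \<Rightarrow> nat" where
  "fam_size S = (\<Sum>e\<leftarrow>S. Suc (length (snd e)))"

definition fam_size_pt :: "'a family \<Rightarrow> nat" where
  "fam_size_pt S = (\<Sum>e\<leftarrow>S. Suc (length (snd e)) - (if head_pt e then 1 else 0))"

fun rank :: "'a spatial \<Rightarrow> 'a family \<Rightarrow> nat" where
  "rank (PointsTo t u # \<Sigma>) S = length \<Sigma> + fam_size_pt S"
| "rank \<Sigma> S = length \<Sigma> + fam_size S"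

fun rank_arr :: "'a spatial \<Rightarrow> 'a family \<Rightarrow> nat" where
  "rank_arr (PointsTo t u # \<Sigma>) S = Suc (length (filter head_arr S))"
| "rank_arr \<Sigma> S = 0"

lemma fam_size_pt_le: "fam_size_pt S \<le> fam_size S"
  unfolding fam_size_pt_def fam_size_def by (rule sum_list_mono) auto

lemma fam_size_pt_less: "e \<in> set S \<Longrightarrow> head_pt e \<Longrightarrow> fam_size_pt S < fam_size S"
proof (induction S)
  case (Cons a S)
  have "fam_size_pt S \<le> fam_size S"
    by (rule fam_size_pt_le)
  with Cons show ?case
    by (auto simp: fam_size_pt_def fam_size_def)
qed simp

lemma rank_le: "rank \<Sigma> S \<le> length \<Sigma> + fam_size S"
  by (cases "(\<Sigma>, S)" rule: rank.cases) (use fam_size_pt_le[of S] in auto)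

lemma head_emp_iff: "head_emp e \<longleftrightarrow> (\<exists>\<Sigma>. snd e = Emp # \<Sigma>)"
  by (cases e rule: head_emp.cases) auto

lemma head_pt_iff: "head_pt e \<longleftrightarrow> (\<exists>t u \<Sigma>. snd e = PointsTo t u # \<Sigma>)"
  by (cases e rule: head_pt.cases) auto

lemma head_arr_iff: "head_arr e \<longleftrightarrow> (\<exists>t u \<Sigma>. snd e = Arr t u # \<Sigma>)"
  by (cases e rule: head_arr.cases) auto

lemma fam_size_simps [simp]:
  "fam_size [] = 0" "fam_size_pt [] = 0"
  "fam_size (e # S) = Suc (length (snd e)) + fam_size S"
  "fam_size_pt (e # S) = Suc (length (snd e)) - (if head_pt e then 1 else 0) + fam_size_pt S"
  "fam_size (S @ S') = fam_size S + fam_size S'"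
  "fam_size_pt (S @ S') = fam_size_pt S + fam_size_pt S'"
  by (simp_all add: fam_size_def fam_size_pt_def)

lemma fam_size_match_pt:
  "(\<And>e. e \<in> set S \<Longrightarrow> head_pt e) \<Longrightarrow> fam_size (map (match_pt t u) S) = fam_size_pt S"
proof (induction S)
  case (Cons e S)
  then have "head_pt e"
    by simp
  then have "length (snd (match_pt t u e)) = length (snd e) - 1" "snd e \<noteq> []"
    by (auto simp: match_pt_def head_pt_iff Let_def split: prod.splits)
  with Cons show ?case
    by simp
qed simp

lemma length_cut_arr: "length (cut_arr J t m S) = length S"
  by (simp add: cut_arr_def)

lemma length_snd_cut_arr:
  assumes "i < length S" and "snd (S ! i) \<noteq> []"
  shows "length (snd (cut_arr J t m S ! i)) = length (snd (S ! i)) - (if i \<in> set J then 1 else 0)"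
  using assms by (auto simp: cut_arr_def Let_def split: prod.splits)

lemma fam_size_nth: "fam_size S = (\<Sum>i<length S. Suc (length (snd (S ! i))))"
  by (simp add: fam_size_def sum_list_sum_nth atLeast0LessThan)

lemma fam_size_cut_arr_le:
  assumes "\<And>e. e \<in> set S \<Longrightarrow> snd e \<noteq> []"
  shows "fam_size (cut_arr J t m S) \<le> fam_size S"
  unfolding fam_size_nth[of S] fam_size_nth[of "cut_arr J t m S"] length_cut_arr
  by (rule sum_mono) (simp add: assms length_snd_cut_arr)

lemma fam_size_cut_arr_less:
  assumes "\<And>e. e \<in> set S \<Longrightarrow> snd e \<noteq> []" and "J \<noteq> []" and "J \<in> set (subseqs [0..<length S])"
  shows "fam_size (cut_arr J t m S) < fam_size S"
proof -
  have "set J \<in> set ` set (subseqs [0..<length S])"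
    using assms(3) by simp
  then have "set J \<subseteq> {0..<length S}"
    unfolding subseqs_powset by simp
  then obtain j where j: "j \<in> set J" "j < length S"
    using assms(2) by (cases J) auto
  show ?thesis
    unfolding fam_size_nth[of S] fam_size_nth[of "cut_arr J t m S"] length_cut_arr
  proof (rule sum_strict_mono_ex1)
    show "\<forall>i\<in>{..<length S}. Suc (length (snd (cut_arr J t m S ! i))) \<le> Suc (length (snd (S ! i)))"
      by (simp add: assms(1) length_snd_cut_arr)
    have "snd (S ! j) \<noteq> []"
      using j assms(1) by simp
    with j have "length (snd (cut_arr J t m S ! j)) < length (snd (S ! j))"
      by (simp add: length_snd_cut_arr)
    with j show "\<exists>i\<in>{..<length S}. Suc (length (snd (cut_arr J t m S ! i))) < Suc (length (snd (S ! i)))"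
      by auto
  qed simp
qed

lemma rank_less: "fam_size S' \<le> n \<Longrightarrow> rank \<Sigma> S' < Suc (length \<Sigma> + n)"
  using rank_le[of \<Sigma> S'] by simp

lemma rank_arr_0: "rank \<Sigma> S = length \<Sigma> + fam_size S \<Longrightarrow> rank_arr \<Sigma> S = 0"
  by (cases "(\<Sigma>, S)" rule: rank.cases) (use fam_size_pt_le[of S] in auto)

lemma rank_match_pt:
  assumes "\<forall>e\<in>set S. \<forall>\<Sigma>. snd e \<noteq> Emp # \<Sigma>" "\<forall>e\<in>set S. snd e \<noteq> []" "\<forall>e\<in>set S. \<not> head_arr e"
    and "\<not> rank \<Sigma> (map (match_pt t u) S) < length \<Sigma> + fam_size_pt S"
  shows "rank \<Sigma> (map (match_pt t u) S) = length \<Sigma> + fam_size_pt S"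
    and "rank_arr \<Sigma> (map (match_pt t u) S) = 0"
proof -
  have "head_pt e" if "e \<in> set S" for e
    using assms that
    by (cases "snd e"; cases "hd (snd e)") (auto simp: head_emp_iff head_pt_iff head_arr_iff)
  then have "fam_size (map (match_pt t u) S) = fam_size_pt S"
    by (rule fam_size_match_pt)
  then show "rank \<Sigma> (map (match_pt t u) S) = length \<Sigma> + fam_size_pt S"
    using rank_le[of \<Sigma> "map (match_pt t u) S"] assms(4) by simp
  with \<open>fam_size (map (match_pt t u) S) = fam_size_pt S\<close>
  show "rank_arr \<Sigma> (map (match_pt t u) S) = 0"
    by (simp add: rank_arr_0)
qed

lemma head_arr_not_pt: "head_arr e \<Longrightarrow> \<not> head_pt e"
  by (auto simp: head_arr_iff head_pt_iff)

termination transl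
  by (relation "measures [\<lambda>(\<nu>, X, \<Pi>, \<Sigma>, S). rank \<Sigma> S, \<lambda>(\<nu>, X, \<Pi>, \<Sigma>, S). rank_arr \<Sigma> S]")
     (auto simp: extract_Some_iff extract_None_iff Let_def case_prod_unfold rank_less head_arr_not_pt
       less_SucI fam_size_pt_less fam_size_cut_arr_le fam_size_cut_arr_less rank_match_pt head_emp_iff)

text \<open>
  Elimination of differences. \<open>pos t\<close> is the sum of the positive parts of \<open>t\<close> and \<open>negs t\<close> lists
  the subtracted parts, which are moved to the other side of an equation: for instance
  \<open>t' + (u - t) = t''\<close> becomes \<open>t' + u = t'' + t\<close>. Equations without differences are not changed.
\<close>

fun pos :: "dtm \<Rightarrow> tm" and negs :: "dtm \<Rightarrow> tm list" where
  "pos (Tm t) = t"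
| "pos (DAdd t u) = Add (pos t) (pos u)"
| "pos (DSub t u) = foldl Add (pos t) (negs u)"
| "negs (Tm t) = []"
| "negs (DAdd t u) = negs t @ negs u"
| "negs (DSub t u) = negs t @ [pos u]"

primrec elim :: "dtm pure \<Rightarrow> tm pure" where
  "elim (PEq t u) = PEq (foldl Add (pos t) (negs u)) (foldl Add (pos u) (negs t))"
| "elim (PAnd p q) = PAnd (elim p) (elim q)"
| "elim (PNot p) = PNot (elim p)"
| "elim (PEx x p) = PEx x (elim p)"

text \<open>
  The computation starts from \<open>\<Pi> \<and> 0 < \<Sigma>\<close>. The clauses that remove a head \<open>t \<mapsto> u\<close> or \<open>Arr(t,t')\<close>
  of \<open>\<Sigma>\<close> drop the conjunct \<open>0 < t\<close> of \<open>Sorted(\<Sigma>)\<close>. Without the additional conjunct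
  the translation of the correct entailment \<open>x \<mapsto> 1 \<Turnstile> 0 < x \<and> x \<mapsto> 1\<close> would not be valid.
\<close>

definition P ::
  "(nat set \<Rightarrow> nat) \<Rightarrow> nat set \<Rightarrow> tm pure \<Rightarrow> tm spatial \<Rightarrow> tm family \<Rightarrow> tm pure" where
  "P \<nu> X \<Pi> \<Sigma> S = (let \<Sigma>' = map (map_atom Tm) \<Sigma> in
     elim (transl \<nu> X (PAnd (map_pure Tm \<Pi>) (below (num 0) \<Sigma>')) \<Sigma>'
       (map (\<lambda>(\<Pi>i, \<Sigma>i). (map_pure Tm \<Pi>i, map (map_atom Tm) \<Sigma>i)) S)))"

end

theory Submission
  imports Defs
begin

text \<open>
  For a fixed store, the translation is valid iff every sorted heap of the left-hand side is covered
  by some disjunct for some values of the existential variables. This equivalence is an induction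
  over the clauses. Each clause either removes the smallest cells from the heap on both sides or
  splits into cases with exclusive guards. Array lengths on the right do not depend on the
  existential variables, and on the left nothing does, so these variables cannot influence which
  guard is true, and \<open>\<exists>y\<close> can be moved through the conjunction over the cases: all conjuncts but one
  are true because their guard is false. A fresh variable is universally quantified and stands for
  the unknown content of the first cell of an array on the left.
\<close>

section \<open>Integer semantics of terms with differences\<close>

text \<open>Sortedness makes a heap readable from left to right: the head of a sorted spatial
  formula must own the least addresses, so no splitting of the heap has to be guessed and both sides
  can be stripped of the same cells. Two obstacles shape the invariants. Stripping is an equivalence
  only if every sorted heap of the remaining left-hand side extends downwards to one of the whole,
  hence the sortedness conditions added to the guards. Moreover, the guards mention the terms of
  right-hand arrays, which may contain variables of \<open>y\<close>, and after a cut by a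
  right-hand length so does the left-hand side itself. Absence of \<open>y\<close> is therefore not
  preserved syntactically; it is replaced by constancy of values over all stores that agree on
  \<open>X - Y\<close>. Equations between starting addresses, by contrast, may depend on
  \<open>y\<close>; they are put into the disjuncts, within the scope of the existential
  quantifier.\<close>

primrec ival :: "store \<Rightarrow> dtm \<Rightarrow> int" where
  "ival s (Tm t) = int (val s t)"
| "ival s (DAdd t u) = ival s t + ival s u"
| "ival s (DSub t u) = ival s t - ival s u"

primrec psat :: "store \<Rightarrow> dtm pure \<Rightarrow> bool" where
  "psat s (PEq t u) \<longleftrightarrow> ival s t = ival s u"
| "psat s (PAnd p q) \<longleftrightarrow> psat s p \<and> psat s q"
| "psat s (PNot p) \<longleftrightarrow> \<not> psat s p"
| "psat s (PEx x p) \<longleftrightarrow> (\<exists>n. psat (s(x := n)) p)"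

section \<open>Stores that agree on a set of variables\<close>

definition agree :: "nat set \<Rightarrow> store \<Rightarrow> store \<Rightarrow> bool" where
  "agree A s s' \<longleftrightarrow> (\<forall>x\<in>A. s x = s' x)"

lemma agree_refl [simp]: "agree A s s"
  by (simp add: agree_def)

lemma agree_sym: "agree A s s' \<Longrightarrow> agree A s' s"
  by (simp add: agree_def)

lemma agree_trans: "agree A s s' \<Longrightarrow> agree A s' s'' \<Longrightarrow> agree A s s''"
  by (simp add: agree_def)

lemma agree_mono: "agree A s s' \<Longrightarrow> B \<subseteq> A \<Longrightarrow> agree B s s'"
  by (auto simp: agree_def)

lemma agree_upd: "agree (A - {x}) s s' \<Longrightarrow> agree A (s(x := n)) (s'(x := n))"
  by (auto simp: agree_def)

lemma agree_compose: "agree X s s1 \<Longrightarrow> agree (- Y) s1 s2 \<Longrightarrow> agree (X - Y) s s2"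
  by (auto simp: agree_def)

text \<open>Takes \<open>s2\<close> on \<open>X\<close> and \<open>s1\<close> elsewhere; the two
  agree on \<open>X - Y\<close>, so the result departs from \<open>s1\<close> only on
  \<open>Y\<close>. For formulas over \<open>X\<close> this turns agreement on \<open>X - Y\<close>
  into agreement off \<open>Y\<close>.\<close>

lemma agree_splice:
  assumes "agree (X - Y) s1 s2"
  obtains s3 where "agree (- Y) s1 s3" "agree X s2 s3"
proof
  show "agree (- Y) s1 (\<lambda>x. if x \<in> X then s2 x else s1 x)"
    and "agree X s2 (\<lambda>x. if x \<in> X then s2 x else s1 x)"
    using assms by (auto simp: agree_def)
qed

lemma val_agree: "agree (vars t) s s' \<Longrightarrow> val s t = val s' t"
  by (induction t) (auto simp: agree_def)

lemma ival_agree: "agree (vars t) s s' \<Longrightarrow> ival s t = ival s' t"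
proof (induction t)
  case (Tm t)
  then show ?case by (simp add: val_agree)
qed (auto simp: agree_def)

lemma finite_vars_tm [simp]: "finite (vars (t::tm))"
  by (induction t) auto

lemma finite_vars_dtm [simp]: "finite (vars (t::dtm))"
  by (induction t) auto

lemma sat_pure_agree: "agree (fv_pure p) s s' \<Longrightarrow> sat_pure s p \<longleftrightarrow> sat_pure s' p"
proof (induction p arbitrary: s s')
  case (PEq t u)
  then have "agree (vars t) s s'" "agree (vars u) s s'" by (auto simp: agree_def)
  then show ?case by (simp add: val_agree)
next
  case (PAnd p q)
  then have "agree (fv_pure p) s s'" "agree (fv_pure q) s s'" by (auto simp: agree_def)
  then show ?case using PAnd.IH[of s s'] by simp
next
  case (PNot p)
  then show ?case by simp
next
  case (PEx x p)
  then have "agree (fv_pure p) (s(x := n)) (s'(x := n))" for n by (simp add: agree_upd)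
  then show ?case using PEx.IH by (metis sat_pure.simps(4))
qed

lemma psat_agree: "agree (fv_pure p) s s' \<Longrightarrow> psat s p \<longleftrightarrow> psat s' p"
proof (induction p arbitrary: s s')
  case (PEq t u)
  then have "agree (vars t) s s'" "agree (vars u) s s'" by (auto simp: agree_def)
  then show ?case by (simp add: ival_agree)
next
  case (PAnd p q)
  then have "agree (fv_pure p) s s'" "agree (fv_pure q) s s'" by (auto simp: agree_def)
  then show ?case using PAnd.IH[of s s'] by simp
next
  case (PNot p)
  then show ?case by simp
next
  case (PEx x p)
  then have "agree (fv_pure p) (s(x := n)) (s'(x := n))" for n by (simp add: agree_upd)
  then show ?case using PEx.IH by (metis psat.simps(4))
qed

section \<open>Elimination of differences and meaning of the derived connectives\<close>

lemma val_foldl_Add: "val s (foldl Add t ts) = val s t + sum_list (map (val s) ts)"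
  by (induction ts arbitrary: t) (simp_all add: algebra_simps)

text \<open>Invariant of the elimination: \<open>pos t\<close> exceeds \<open>t\<close> by exactly
  what is moved away. Adding the \<open>negs\<close> of each side to the \<open>pos\<close> of the
  other therefore raises both sides of an equation by the same amount.\<close>

lemma ival_pos_negs: "int (val s (pos t)) = ival s t + int (sum_list (map (val s) (negs t)))"
  by (induction t) (simp_all add: val_foldl_Add)

lemma sat_pure_elim: "sat_pure s (elim p) \<longleftrightarrow> psat s p"
proof (induction p arbitrary: s)
  case (PEq t u)
  have "val s (foldl Add (pos t) (negs u)) = val s (foldl Add (pos u) (negs t)) \<longleftrightarrow>
    int (val s (pos t)) + int (sum_list (map (val s) (negs u))) =
    int (val s (pos u)) + int (sum_list (map (val s) (negs t)))"
    unfolding val_foldl_Add by linarith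
  then show ?case by (simp add: ival_pos_negs)
qed auto

lemma psat_map_Tm: "psat s (map_pure Tm p) \<longleftrightarrow> sat_pure s p"
  by (induction p arbitrary: s) auto

lemma fv_map_Tm: "fv_pure (map_pure Tm p) = fv_pure p"
  by (induction p) auto

lemma fresh_bound_var:
  "finite A \<Longrightarrow> Suc (Max (insert 0 A)) \<notin> (A :: nat set)"
  by (metis Max_ge finite_insert insertCI not_less_eq_eq order_refl)

text \<open>Quantifiers of \<open>psat\<close> range over naturals while the compared values may be
  negative. Only their gap has to be a natural number, so \<open>PLe\<close> still denotes the order
  of the integers.\<close>

lemma exists_nat_diff: "(\<exists>n. i = j + int n) \<longleftrightarrow> j \<le> i"
  by (metis zle_iff_zadd)

lemma sat_pure_PLe [simp]: "sat_pure s (PLe t u) \<longleftrightarrow> val s t \<le> val s u"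
proof -
  define x where "x = Suc (Max (insert 0 (vars t \<union> vars u)))"
  have "x \<notin> vars t \<union> vars u"
    unfolding x_def by (rule fresh_bound_var) simp
  then have "val (s(x := n)) t = val s t" "val (s(x := n)) u = val s u" for n
    by (auto intro!: val_agree simp: agree_def)
  moreover have "PLe t u = PEx x (PEq u (Add t (Var x)))"
    by (simp add: PLe_def x_def add_tm_def var_tm_def Let_def)
  ultimately show ?thesis by (simp add: le_iff_add)
qed

lemma psat_PLe [simp]: "psat s (PLe t u) \<longleftrightarrow> ival s t \<le> ival s u"
proof -
  define x where "x = Suc (Max (insert 0 (vars t \<union> vars u)))"
  have "x \<notin> vars t \<union> vars u"
    unfolding x_def by (rule fresh_bound_var) simp
  then have "ival (s(x := n)) t = ival s t" "ival (s(x := n)) u = ival s u" for n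
    by (auto intro!: ival_agree simp: agree_def)
  moreover have "PLe t u = PEx x (PEq u (DAdd t (Tm (Var x))))"
    by (simp add: PLe_def x_def add_dtm_def var_dtm_def Let_def)
  ultimately show ?thesis by (simp add: exists_nat_diff)
qed

lemma ival_simps [simp]:
  "ival s (t \<oplus> u) = ival s t + ival s u" "ival s (num n) = int n" "ival s (var x) = int (s x)"
  by (simp_all add: add_dtm_def num_dtm_def var_dtm_def)

lemma val_simps [simp]:
  "val s (t \<oplus> u) = val s t + val s u" "val s (num n) = n"
  by (simp_all add: add_tm_def num_tm_def)

lemma vars_simps [simp]:
  "vars (t \<oplus> u) = vars t \<union> vars (u::dtm)" "vars (num n :: dtm) = {}" "vars (var x :: dtm) = {x}"
  by (simp_all add: add_dtm_def num_dtm_def var_dtm_def)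

lemma psat_simps [simp]:
  "psat s PTrue" "psat s (PLt t u) \<longleftrightarrow> ival s t < ival s u"
  "psat s (POr p q) \<longleftrightarrow> psat s p \<or> psat s q" "psat s (PImp p q) \<longleftrightarrow> (psat s p \<longrightarrow> psat s q)"
  "psat s (PConj ps) \<longleftrightarrow> (\<forall>p\<in>set ps. psat s p)" "psat s (PDisj ps) \<longleftrightarrow> (\<exists>p\<in>set ps. psat s p)"
proof -
  show *: "psat s PTrue" by (simp add: PTrue_def)
  show "psat s (PLt t u) \<longleftrightarrow> ival s t < ival s u" by (auto simp: PLt_def)
  show "psat s (POr p q) \<longleftrightarrow> psat s p \<or> psat s q" for p q by (simp add: POr_def)
  then show "psat s (PDisj ps) \<longleftrightarrow> (\<exists>p\<in>set ps. psat s p)"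
    by (induction ps) (simp_all add: PDisj_def *)
  show "psat s (PImp p q) \<longleftrightarrow> (psat s p \<longrightarrow> psat s q)" by (simp add: PImp_def)
  show "psat s (PConj ps) \<longleftrightarrow> (\<forall>p\<in>set ps. psat s p)"
    by (induction ps) (simp_all add: PConj_def *)
qed

lemma sat_pure_simps [simp]:
  "sat_pure s PTrue" "sat_pure s (PLt t u) \<longleftrightarrow> val s t < val s u"
  by (auto simp: PTrue_def PLt_def)

lemma fv_pure_simps [simp]:
  "fv_pure (PTrue :: dtm pure) = {}" "fv_pure (PTrue :: tm pure) = {}"
  "fv_pure (PConj ps :: dtm pure) = (\<Union>p\<in>set ps. fv_pure p)"
proof -
  show *: "fv_pure (PTrue :: dtm pure) = {}"
    and "fv_pure (PTrue :: tm pure) = {}"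
    by (simp_all add: PTrue_def num_tm_def)
  show "fv_pure (PConj ps :: dtm pure) = (\<Union>p\<in>set ps. fv_pure p)"
    by (induction ps) (simp_all add: PConj_def *)
qed

lemma fv_PLe: "fv_pure (PLe t (u::dtm)) \<subseteq> vars t \<union> vars u"
  by (auto simp: PLe_def Let_def)

lemma fv_PLt: "fv_pure (PLt t (u::dtm)) \<subseteq> vars t \<union> vars u"
  using fv_PLe[of "t \<oplus> num 1" u] by (simp add: PLt_def)

lemma fv_spatial_simps [simp]:
  "fv_spatial [] = {}" "fv_spatial (Emp # \<Sigma>) = fv_spatial \<Sigma>"
  "fv_spatial (PointsTo t u # \<Sigma>) = vars t \<union> vars u \<union> fv_spatial \<Sigma>"
  "fv_spatial (Arr t u # \<Sigma>) = vars t \<union> vars u \<union> fv_spatial \<Sigma>"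
  by (simp_all add: fv_spatial_def)

lemma fv_below: "fv_pure (below t (\<Sigma> :: dtm spatial)) \<subseteq> vars t \<union> fv_spatial \<Sigma>"
  using fv_PLt by (induction t \<Sigma> rule: below.induct) fastforce+

section \<open>Sorted heaps\<close>

text \<open>
  Integer addresses avoid all side conditions on differences. The contents stay natural
  numbers because a fresh variable has to be able to denote the content of an array cell.
\<close>

type_synonym iheap = "int \<rightharpoonup> nat"

abbreviation beyond :: "iheap \<Rightarrow> int \<Rightarrow> iheap" where
  "beyond h a \<equiv> h |` {a<..}"

text \<open>Sortedness and separating conjunction in one recursion: the head owns the least
  addresses, the rest owns whatever lies beyond them. Positivity of the first address is not
  included and is carried along separately.\<close>

fun ssat :: "iheap \<Rightarrow> int spatial \<Rightarrow> bool" where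
  "ssat h [] \<longleftrightarrow> h = Map.empty"
| "ssat h (Emp # L) \<longleftrightarrow> ssat h L"
| "ssat h (PointsTo a v # L) \<longleftrightarrow>
     map_option int (h a) = Some v \<and> (\<forall>x\<in>dom h. a \<le> x) \<and> ssat (beyond h a) L"
| "ssat h (Arr a b # L) \<longleftrightarrow>
     a \<le> b \<and> {a..b} \<subseteq> dom h \<and> (\<forall>x\<in>dom h. a \<le> x) \<and> ssat (beyond h b) L"

fun lt_head :: "int \<Rightarrow> int spatial \<Rightarrow> bool" where
  "lt_head a [] \<longleftrightarrow> True"
| "lt_head a (Emp # L) \<longleftrightarrow> lt_head a L"
| "lt_head a (PointsTo b v # L) \<longleftrightarrow> a < b"
| "lt_head a (Arr b c # L) \<longleftrightarrow> a < b"

fun lsorted :: "int spatial \<Rightarrow> bool" where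
  "lsorted [] \<longleftrightarrow> True"
| "lsorted (Emp # L) \<longleftrightarrow> lsorted L"
| "lsorted (PointsTo a v # L) \<longleftrightarrow> lt_head a L \<and> lsorted L"
| "lsorted (Arr a b # L) \<longleftrightarrow> a \<le> b \<and> lt_head b L \<and> lsorted L"

abbreviation ev :: "store \<Rightarrow> dtm spatial \<Rightarrow> int spatial" where
  "ev s \<Sigma> \<equiv> map (map_atom (ival s)) \<Sigma>"

lemma psat_below [simp]: "psat s (below t \<Sigma>) \<longleftrightarrow> lt_head (ival s t) (ev s \<Sigma>)"
  by (induction t \<Sigma> rule: below.induct) auto

lemma psat_sorted' [simp]: "psat s (sorted' \<Sigma>) \<longleftrightarrow> lsorted (ev s \<Sigma>)"
  by (induction \<Sigma> rule: sorted'.induct) auto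

lemma ev_agree: "agree (fv_spatial \<Sigma>) s s' \<Longrightarrow> ev s \<Sigma> = ev s' \<Sigma>"
  unfolding fv_spatial_def
  by (fastforce intro!: atom.map_cong ival_agree elim: agree_mono)

lemma beyond_beyond [simp]: "a \<le> b \<Longrightarrow> beyond (beyond h a) b = beyond h b"
  by (rule ext) (auto simp: restrict_map_def)

text \<open>The first proper atom sits at the least address of \<open>h\<close>, so a test on the
  list becomes a bound on the domain; without a proper atom the domain is empty.\<close>

lemma lt_head_iff: "ssat h L \<Longrightarrow> lt_head a L \<longleftrightarrow> (\<forall>x\<in>dom h. a < x)"
proof (induction L rule: lt_head.induct)
  case (3 a b v L)
  then have "b \<in> dom h" "\<forall>x\<in>dom h. b \<le> x" by auto
  then show ?case using less_le_trans by auto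
next
  case (4 a b c L)
  then have "b \<in> dom h" "\<forall>x\<in>dom h. b \<le> x" by auto
  then show ?case using less_le_trans by auto
qed auto

text \<open>The reason why the \<open>below\<close> conjuncts in the disjuncts do no harm: what
  holds beyond \<open>a\<close> starts above \<open>a\<close> anyway.\<close>

lemma ssat_lt_head: "ssat (beyond h a) L \<Longrightarrow> lt_head a L"
  by (auto simp: lt_head_iff)

lemma ssat_lsorted: "ssat h L \<Longrightarrow> lsorted L"
  by (induction h L rule: ssat.induct) (auto simp: ssat_lt_head)

text \<open>By sortedness all cells of \<open>h2\<close> lie above \<open>b\<close>, so filling
  \<open>{a..b}\<close> cannot clash with them. This supplies the converse direction whenever a
  clause strips cells from the left-hand side.\<close>

lemma extend_heap:
  assumes "ssat h2 L" and "lt_head b L" and "a \<le> b"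
  obtains h where "beyond h b = h2" "{a..b} \<subseteq> dom h" "\<forall>x\<in>dom h. a \<le> x" "h a = Some v"
proof
  have *: "x \<in> dom h2 \<Longrightarrow> b < x" for x
    using assms(1,2) lt_head_iff by blast
  define h where "h = (\<lambda>x. if x \<in> {a..b} then Some v else h2 x)"
  show "beyond h b = h2"
  proof
    fix x
    show "beyond h b x = h2 x"
      using *[of x] by (cases "h2 x") (auto simp: h_def restrict_map_def)
  qed
  show "{a..b} \<subseteq> dom h" and "h a = Some v" and "\<forall>x\<in>dom h. a \<le> x"
    using assms(3) * by (force simp: h_def split: if_splits)+
qed

text \<open>Lists carry integer contents but heaps natural ones; a sorted list with a negative
  content has no heap at all.\<close>

abbreviation conts_ok :: "int spatial \<Rightarrow> bool" where
  "conts_ok L \<equiv> (\<forall>a v. PointsTo a v \<in> set L \<longrightarrow> 0 \<le> v)"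

text \<open>The heap is built from the last atom backwards, each atom adding cells below the
  existing ones. It serves as the counterexample when no disjunct is left.\<close>

lemma lsorted_ssat: "lsorted L \<Longrightarrow> conts_ok L \<Longrightarrow> \<exists>h. ssat h L"
proof (induction L rule: lsorted.induct)
  case (3 a v L)
  then obtain h2 where h2: "ssat h2 L" by auto
  with 3 obtain h where "beyond h a = h2" "\<forall>x\<in>dom h. a \<le> x" "h a = Some (nat v)"
    by (metis extend_heap lsorted.simps(3) order_refl)
  moreover have "0 \<le> v" using 3 by auto
  ultimately have "ssat h (PointsTo a v # L)" using h2 by simp
  then show ?case by blast
next
  case (4 a b L)
  then obtain h2 where h2: "ssat h2 L" by auto
  with 4 obtain h where "beyond h b = h2" "{a..b} \<subseteq> dom h" "\<forall>x\<in>dom h. a \<le> x"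
    by (metis extend_heap lsorted.simps(4))
  with h2 4 have "ssat h (Arr a b # L)" by simp
  then show ?case by blast
qed auto

text \<open>The bound \<open>c < b\<close> leaves at least one cell for the remaining array. That no
  cell beyond \<open>c\<close> precedes \<open>c + 1\<close> is automatic for integer
  addresses.\<close>

lemma ssat_Arr_split:
  assumes "a \<le> c" and "c < b"
  shows "ssat h (Arr a b # L) \<longleftrightarrow>
    {a..c} \<subseteq> dom h \<and> (\<forall>x\<in>dom h. a \<le> x) \<and> ssat (beyond h c) (Arr (c + 1) b # L)"
proof -
  have "{a..b} \<subseteq> dom h \<longleftrightarrow> {a..c} \<subseteq> dom h \<and> {c + 1..b} \<subseteq> dom (beyond h c)"
  proof -
    have "{a..b} = {a..c} \<union> {c + 1..b}" using assms by auto
    moreover have "{c + 1..b} \<subseteq> dom (beyond h c) \<longleftrightarrow> {c + 1..b} \<subseteq> dom h" by auto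
    ultimately show ?thesis by auto
  qed
  moreover have "beyond (beyond h c) b = beyond h b"
    using assms by (intro beyond_beyond) simp
  ultimately show ?thesis
    unfolding ssat.simps using assms by auto
qed

text \<open>An array on the right may borrow the content of the least cell: if either side holds,
  \<open>b\<close> belongs to the domain and bounds it from below, hence \<open>b = a\<close> and
  the cell at \<open>b\<close> contains \<open>v\<close>.\<close>

lemma ssat_Arr_single:
  "h a = Some v \<Longrightarrow> (\<forall>x\<in>dom h. a \<le> x) \<Longrightarrow>
     ssat h (Arr b b # L) \<longleftrightarrow> ssat h (PointsTo b (int v) # L)"
proof -
  assume *: "h a = Some v" "\<forall>x\<in>dom h. a \<le> x"
  then have "a = b" if "b \<in> dom h" "\<forall>x\<in>dom h. b \<le> x"
    using that by (meson domI order_antisym)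
  with * show ?thesis by auto
qed

lemma ssat_Arr_first:
  "h a = Some v \<Longrightarrow> (\<forall>x\<in>dom h. a \<le> x) \<Longrightarrow> b < c \<Longrightarrow>
     ssat h (Arr b c # L) \<longleftrightarrow> ssat h (PointsTo b (int v) # Arr (b + 1) c # L)"
proof -
  assume *: "h a = Some v" "\<forall>x\<in>dom h. a \<le> x" and "b < c"
  then have "a = b" if "b \<in> dom h" "\<forall>x\<in>dom h. b \<le> x"
    using that by (meson domI order_antisym)
  with * show ?thesis
    unfolding ssat_Arr_split[OF order_refl \<open>b < c\<close>] ssat.simps(3) by auto
qed

section \<open>The clauses of the translation\<close>

text \<open>Without the order of the clauses, which correctness does not depend on.\<close>

inductive computes ::
  "(nat set \<Rightarrow> nat) \<Rightarrow> nat set \<Rightarrow> dtm pure \<Rightarrow> dtm spatial \<Rightarrow> dtm family \<Rightarrow> dtm pure \<Rightarrow> bool"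
  for \<nu> where
  EmpL: "computes \<nu> X \<Pi> \<Sigma> S \<phi> \<Longrightarrow> computes \<nu> X \<Pi> (Emp # \<Sigma>) S \<phi>"
| EmpR: "computes \<nu> X \<Pi> \<Sigma> (S1 @ (\<Pi>', \<Sigma>') # S2) \<phi> \<Longrightarrow>
    computes \<nu> X \<Pi> \<Sigma> (S1 @ (\<Pi>', Emp # \<Sigma>') # S2) \<phi>"
| EmpNEmp: "\<Sigma>' \<noteq> [] \<Longrightarrow> hd \<Sigma>' \<noteq> Emp \<Longrightarrow> computes \<nu> X \<Pi> [] (S1 @ S2) \<phi> \<Longrightarrow>
    computes \<nu> X \<Pi> [] (S1 @ (\<Pi>', \<Sigma>') # S2) \<phi>"
| EmpEmp: "\<forall>e\<in>set S. snd e = [] \<Longrightarrow> computes \<nu> X \<Pi> [] S (PImp \<Pi> (PDisj (map fst S)))"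
| NEmpEmp: "\<Sigma> \<noteq> [] \<Longrightarrow> hd \<Sigma> \<noteq> Emp \<Longrightarrow> computes \<nu> X \<Pi> \<Sigma> (S1 @ S2) \<phi> \<Longrightarrow>
    computes \<nu> X \<Pi> \<Sigma> (S1 @ (\<Pi>', []) # S2) \<phi>"
| empty: "computes \<nu> X \<Pi> \<Sigma> [] (PNot (PAnd \<Pi> (sorted_sp \<Sigma>)))"
| PtPt: "\<forall>e\<in>set S. head_pt e \<Longrightarrow>
    computes \<nu> X (PAnd \<Pi> (below t \<Sigma>)) \<Sigma> (map (match_pt t u) S) \<phi> \<Longrightarrow>
    computes \<nu> X \<Pi> (PointsTo t u # \<Sigma>) S \<phi>"
| PtArr: "
    computes \<nu> X (PAnd \<Pi> (PEq b a)) (PointsTo t u # \<Sigma>) (S1 @ (\<Pi>', PointsTo a u # \<Sigma>') # S2) \<phi>1 \<Longrightarrow>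
    computes \<nu> X (PAnd \<Pi> (PLt a b)) (PointsTo t u # \<Sigma>)
      (S1 @ (\<Pi>', PointsTo a u # Arr (a \<oplus> num 1) b # \<Sigma>') # S2) \<phi>2 \<Longrightarrow>
    computes \<nu> X (PAnd \<Pi> (PLt b a)) (PointsTo t u # \<Sigma>) (S1 @ S2) \<phi>3 \<Longrightarrow>
    computes \<nu> X \<Pi> (PointsTo t u # \<Sigma>) (S1 @ (\<Pi>', Arr a b # \<Sigma>') # S2) (PConj [\<phi>1, \<phi>2, \<phi>3])"
| ArrPt: "z = \<nu> X \<Longrightarrow> z' = \<nu> (insert z X) \<Longrightarrow> X' = insert z' (insert z X) \<Longrightarrow>
    computes \<nu> X' (PAnd \<Pi> (PLt t t')) (PointsTo t (var z) # Arr (t \<oplus> num 1) t' # \<Sigma>) S \<phi>1 \<Longrightarrow>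
    computes \<nu> X' (PAnd \<Pi> (PEq t' t)) (PointsTo t (var z') # \<Sigma>) S \<phi>2 \<Longrightarrow>
    computes \<nu> X \<Pi> (Arr t t' # \<Sigma>) S (PAnd \<phi>1 \<phi>2)"
| ArrArr: "\<forall>e\<in>set S. head_arr e \<Longrightarrow> m = DSub t' t \<Longrightarrow>
    (\<And>J. J \<in> set (subseqs [0..<length S]) \<Longrightarrow>
      computes \<nu> X (PConj [\<Pi>, shortest J m S, PLe t t', below t' \<Sigma>]) \<Sigma> (cut_arr J t m S) (F J)) \<Longrightarrow>
    (\<And>J. J \<in> set (subseqs [0..<length S]) \<Longrightarrow> J \<noteq> [] \<Longrightarrow> m' J = arr_len (S ! hd J)) \<Longrightarrow>
    (\<And>J. J \<in> set (subseqs [0..<length S]) \<Longrightarrow> J \<noteq> [] \<Longrightarrow>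
      computes \<nu> X (PConj [\<Pi>, PLt (m' J) m, shortest J (m' J) S])
        (Arr (t \<oplus> m' J \<oplus> num 1) t' # \<Sigma>) (cut_arr J t (m' J) S) (G J)) \<Longrightarrow>
    computes \<nu> X \<Pi> (Arr t t' # \<Sigma>) S
      (PAnd (PConj (map F (subseqs [0..<length S])))
            (PConj (map G (filter (\<lambda>J. J \<noteq> []) (subseqs [0..<length S])))))"

section \<open>The recursive translation obeys the clauses\<close>

lemma head_arr_if: "\<not> head_emp e \<Longrightarrow> \<not> head_pt e \<Longrightarrow> snd e \<noteq> [] \<Longrightarrow> head_arr e"
  by (cases e rule: head_arr.cases) auto

lemma head_pt_if: "\<not> head_emp e \<Longrightarrow> \<not> head_arr e \<Longrightarrow> snd e \<noteq> [] \<Longrightarrow> head_pt e"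
  by (cases e rule: head_arr.cases) auto

lemma not_head_emp: "\<not> head_emp e \<Longrightarrow> snd e \<noteq> [] \<Longrightarrow> hd (snd e) \<noteq> Emp"
  by (cases e rule: head_arr.cases) auto

lemma extract_emp_cases:
  obtains S1 \<Pi>' \<Sigma>' S2 where "List.extract head_emp S = Some (S1, (\<Pi>', Emp # \<Sigma>'), S2)"
      "S = S1 @ (\<Pi>', Emp # \<Sigma>') # S2"
  | "List.extract head_emp S = None" "\<forall>e\<in>set S. \<not> head_emp e"
proof (cases "List.extract head_emp S")
  case (Some r)
  obtain S1 e S2 where r: "r = (S1, e, S2)" by (cases r)
  with Some have "head_emp e" "S = S1 @ e # S2" by (auto simp: extract_Some_iff)
  then show ?thesis using that(1) Some r by (cases e) (auto simp: head_emp_iff)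
qed (use that(2) in \<open>auto simp: extract_None_iff\<close>)

lemma extract_snd_cases:
  obtains S1 \<Pi>' \<Sigma>' S2 where "List.extract (\<lambda>(\<Pi>', \<Sigma>'). Q \<Sigma>') S = Some (S1, (\<Pi>', \<Sigma>'), S2)"
      "S = S1 @ (\<Pi>', \<Sigma>') # S2" "Q \<Sigma>'"
  | "List.extract (\<lambda>(\<Pi>', \<Sigma>'). Q \<Sigma>') S = None" "\<forall>e\<in>set S. \<not> Q (snd e)"
proof (cases "List.extract (\<lambda>(\<Pi>', \<Sigma>'). Q \<Sigma>') S")
  case (Some r)
  obtain S1 \<Pi>' \<Sigma>' S2 where r: "r = (S1, (\<Pi>', \<Sigma>'), S2)" by (cases r) auto
  with Some have "Q \<Sigma>'" "S = S1 @ (\<Pi>', \<Sigma>') # S2" by (auto simp: extract_Some_iff)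
  then show ?thesis using that(1) Some r by auto
qed (use that(2) in \<open>fastforce simp: extract_None_iff\<close>)

lemma extract_arr_cases:
  obtains S1 \<Pi>' a b \<Sigma>' S2 where "List.extract head_arr S = Some (S1, (\<Pi>', Arr a b # \<Sigma>'), S2)"
      "S = S1 @ (\<Pi>', Arr a b # \<Sigma>') # S2"
  | "List.extract head_arr S = None" "\<forall>e\<in>set S. \<not> head_arr e"
proof (cases "List.extract head_arr S")
  case (Some r)
  obtain S1 e S2 where r: "r = (S1, e, S2)" by (cases r)
  with Some have "head_arr e" "S = S1 @ e # S2" by (auto simp: extract_Some_iff)
  then show ?thesis using that(1) Some r by (cases e) (auto simp: head_arr_iff)
qed (use that(2) in \<open>auto simp: extract_None_iff\<close>)

declare transl.simps [simp del]

text \<open>The order of the clauses supplies the side conditions: once no element with head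
  \<open>Emp\<close> and no empty element can be extracted, each head is a points-to atom or an
  array, and excluding one kind forces the other.\<close>

lemma computes_transl: "computes \<nu> X \<Pi> \<Sigma> S (transl \<nu> X \<Pi> \<Sigma> S)"
proof (induction \<nu> X \<Pi> \<Sigma> S rule: transl.induct)
  case (1 \<nu> X \<Pi> \<Sigma> S)
  then show ?case by (simp add: EmpL transl.simps(1))
next
  case (2 \<nu> X \<Pi> S)
  show ?case
  proof (cases S rule: extract_emp_cases)
    case *: (1 S1 \<Pi>' \<Sigma>' S2)
    then show ?thesis using 2(2)[OF *(1) refl refl] unfolding transl.simps(2)[of \<nu> X \<Pi> S] by (simp add: EmpR)
  next
    case emp: 2
    show ?thesis
    proof (rule extract_snd_cases[where Q = "\<lambda>\<Sigma>' :: dtm spatial. \<Sigma>' \<noteq> []" and S = S], goal_cases)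
      case *: (1 S1 \<Pi>' \<Sigma>' S2)
      moreover have "hd \<Sigma>' \<noteq> Emp"
        using emp(2) * not_head_emp[of "(\<Pi>', \<Sigma>')"] by simp
      ultimately show ?thesis
        using 2(1)[OF emp(1) *(1) refl refl] emp(1) unfolding transl.simps(2)[of \<nu> X \<Pi> S] by (simp add: EmpNEmp)
    next
      case 2
      then show ?thesis using emp(1) unfolding transl.simps(2)[of \<nu> X \<Pi> S] by (simp add: EmpEmp)
    qed
  qed
next
  case (3 \<nu> X \<Pi> t u \<Sigma> S)
  show ?case
  proof (cases S rule: extract_emp_cases)
    case *: (1 S1 \<Pi>' \<Sigma>' S2)
    then show ?thesis using 3(6)[OF *(1) refl refl] unfolding transl.simps(3)[of \<nu> X \<Pi> t u \<Sigma> S] by (simp add: EmpR)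
  next
    case emp: 2
    show ?thesis
    proof (rule extract_snd_cases[where Q = "\<lambda>\<Sigma>' :: dtm spatial. \<Sigma>' = []" and S = S], goal_cases)
      case *: (1 S1 \<Pi>' \<Sigma>' S2)
      then show ?thesis
        using 3(5)[OF emp(1) *(1) refl refl] emp(1) unfolding transl.simps(3)[of \<nu> X \<Pi> t u \<Sigma> S] by (simp add: NEmpEmp)
    next
      case nil: 2
      show ?thesis
      proof (cases "S = []")
        case True
        then show ?thesis using emp(1) nil(1) unfolding transl.simps(3)[of \<nu> X \<Pi> t u \<Sigma> S] by (simp add: empty)
      next
        case False
        show ?thesis
        proof (cases S rule: extract_arr_cases)
          case *: (1 S1 \<Pi>' a b \<Sigma>' S2)
          note prems = emp(1) nil(1) False *(1) refl refl refl refl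
          show ?thesis
            using 3(2)[OF prems] 3(3)[OF prems] 3(4)[OF prems] emp(1) nil(1) False *
            unfolding transl.simps(3)[of \<nu> X \<Pi> t u \<Sigma> S] by (simp add: PtArr Let_def)
        next
          case 2
          then show ?thesis
            using 3(1)[OF emp(1) nil(1) False] emp nil False
            unfolding transl.simps(3)[of \<nu> X \<Pi> t u \<Sigma> S] by (simp add: PtPt head_pt_if)
        qed
      qed
    qed
  qed
next
  case (4 \<nu> X \<Pi> t t' \<Sigma> S)
  show ?case
  proof (cases S rule: extract_emp_cases)
    case *: (1 S1 \<Pi>' \<Sigma>' S2)
    then show ?thesis using 4(6)[OF *(1) refl refl] unfolding transl.simps(4)[of \<nu> X \<Pi> t t' \<Sigma> S] by (simp add: EmpR)
  next
    case emp: 2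
    show ?thesis
    proof (rule extract_snd_cases[where Q = "\<lambda>\<Sigma>' :: dtm spatial. \<Sigma>' = []" and S = S], goal_cases)
      case *: (1 S1 \<Pi>' \<Sigma>' S2)
      then show ?thesis
        using 4(5)[OF emp(1) *(1) refl refl] emp(1) unfolding transl.simps(4)[of \<nu> X \<Pi> t t' \<Sigma> S] by (simp add: NEmpEmp)
    next
      case nil: 2
      show ?thesis
      proof (cases "S = []")
        case True
        then show ?thesis using emp(1) nil(1) unfolding transl.simps(4)[of \<nu> X \<Pi> t t' \<Sigma> S] by (simp add: empty)
      next
        case False
        show ?thesis
        proof (cases "\<exists>e\<in>set S. head_pt e")
          case True
          note prems = emp(1) nil(1) False True refl refl refl
          show ?thesis
            using 4(1)[OF prems] 4(2)[OF prems] emp(1) nil(1) False True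
            unfolding transl.simps(4)[of \<nu> X \<Pi> t t' \<Sigma> S] by (simp add: ArrPt Let_def)
        next
          case no_pt: False
          then have "\<forall>e\<in>set S. head_arr e"
            using emp(2) nil(2) head_arr_if by blast
          note prems = emp(1) nil(1) False no_pt refl
          show ?thesis
            using 4(3)[OF prems] 4(4)[OF prems] emp(1) nil(1) False no_pt \<open>\<forall>e\<in>set S. head_arr e\<close>
            unfolding transl.simps(4)[of \<nu> X \<Pi> t t' \<Sigma> S] by (simp add: ArrArr Let_def)
        qed
      qed
    qed
  qed
qed

text \<open>Clauses only add conjuncts to \<open>\<Pi>\<close>, so a false guard stays false down to
  the leaves, where it is the premise of an implication or lies under a negation. This is how all
  cases but the relevant one are discarded.\<close>

lemma computes_trivial: "computes \<nu> X \<Pi> \<Sigma> S \<phi> \<Longrightarrow> \<not> psat s \<Pi> \<Longrightarrow> psat s \<phi>"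
  by (induction rule: computes.induct) auto

section \<open>Correctness of the translation\<close>

text \<open>
  A store is split into the part on \<open>X - Y\<close>, which is given, the variables outside \<open>X\<close>, which
  may still be introduced as fresh variables and are universal, and those in \<open>Y\<close>, which are
  existential.
\<close>

definition valid_at :: "nat set \<Rightarrow> nat set \<Rightarrow> store \<Rightarrow> dtm pure \<Rightarrow> bool" where
  "valid_at X Y s \<phi> \<longleftrightarrow> (\<forall>s1. agree X s s1 \<longrightarrow> (\<exists>s2. agree (- Y) s1 s2 \<and> psat s2 \<phi>))"

definition esat :: "store \<Rightarrow> iheap \<Rightarrow> dtm pure \<times> dtm spatial \<Rightarrow> bool" where
  "esat s h e \<longleftrightarrow> psat s (fst e) \<and> ssat h (ev s (snd e))"

text \<open>Variables outside \<open>X\<close> are released together with those of \<open>Y\<close>;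
  members of the family do not mention them. The range of \<open>s2\<close> thus coincides with the
  stores over which the left-hand side is constant.\<close>

definition covered :: "nat set \<Rightarrow> nat set \<Rightarrow> store \<Rightarrow> dtm family \<Rightarrow> iheap \<Rightarrow> bool" where
  "covered X Y s S h \<longleftrightarrow> (\<exists>s2. agree (X - Y) s s2 \<and> (\<exists>e\<in>set S. esat s2 h e))"

text \<open>Independence of \<open>Y\<close> is demanded of values, not of free variables: guards
  such as \<open>shortest\<close>, and arrays cut by a right-hand length, do contain variables of
  \<open>Y\<close>. The conjunct \<open>lt_head 0\<close> preserves the part of
  \<open>Sorted\<close> that the clauses drop.\<close>

definition left_ok :: "nat set \<Rightarrow> nat set \<Rightarrow> store \<Rightarrow> dtm pure \<Rightarrow> dtm spatial \<Rightarrow> bool" where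
  "left_ok X Y s \<Pi> \<Sigma> \<longleftrightarrow> fv_spatial \<Sigma> \<subseteq> X \<and>
     (\<forall>s'. agree (X - Y) s s' \<longrightarrow> psat s' \<Pi> \<and> ev s' \<Sigma> = ev s \<Sigma>) \<and>
     lt_head 0 (ev s \<Sigma>) \<and> conts_ok (ev s \<Sigma>)"

text \<open>Semantic form of the restriction to \<open>Arr(t,t+u)\<close> with \<open>u\<close> free
  of \<open>Y\<close>; unlike the syntactic form it survives the cutting of an array.\<close>

definition arr_ok :: "nat set \<Rightarrow> nat set \<Rightarrow> store \<Rightarrow> dtm \<Rightarrow> dtm \<Rightarrow> bool" where
  "arr_ok X Y s a b \<longleftrightarrow> ival s a \<le> ival s b \<and>
     (\<forall>s'. agree (X - Y) s s' \<longrightarrow> ival s' b - ival s' a = ival s b - ival s a)"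

definition elem_ok :: "nat set \<Rightarrow> nat set \<Rightarrow> store \<Rightarrow> dtm pure \<times> dtm spatial \<Rightarrow> bool" where
  "elem_ok X Y s e \<longleftrightarrow> fv_pure (fst e) \<subseteq> X \<and> fv_spatial (snd e) \<subseteq> X \<and>
     (\<forall>a b. Arr a b \<in> set (snd e) \<longrightarrow> arr_ok X Y s a b)"

lemma elem_ok_simps [simp]:
  "elem_ok X Y s (\<Pi>, Emp # \<Sigma>) \<longleftrightarrow> elem_ok X Y s (\<Pi>, \<Sigma>)"
  "elem_ok X Y s (\<Pi>, PointsTo t u # \<Sigma>) \<longleftrightarrow> vars t \<subseteq> X \<and> vars u \<subseteq> X \<and> elem_ok X Y s (\<Pi>, \<Sigma>)"
  "elem_ok X Y s (\<Pi>, Arr t u # \<Sigma>) \<longleftrightarrow>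
     vars t \<subseteq> X \<and> vars u \<subseteq> X \<and> arr_ok X Y s t u \<and> elem_ok X Y s (\<Pi>, \<Sigma>)"
  "elem_ok X Y s (PAnd \<Pi> \<Pi>', \<Sigma>) \<longleftrightarrow> fv_pure \<Pi>' \<subseteq> X \<and> elem_ok X Y s (\<Pi>, \<Sigma>)"
  "elem_ok X Y s (PConj (\<Pi> # \<Pi>s), \<Sigma>) \<longleftrightarrow>
     (\<forall>p\<in>set \<Pi>s. fv_pure p \<subseteq> X) \<and> elem_ok X Y s (\<Pi>, \<Sigma>)"
  by (auto simp: elem_ok_def)

lemma elem_ok_fv: "elem_ok X Y s (\<Pi>, \<Sigma>) \<Longrightarrow> fv_pure \<Pi> \<subseteq> X \<and> fv_spatial \<Sigma> \<subseteq> X"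
  by (simp add: elem_ok_def)

section \<open>Validity and coverage under changes of formula, family and variable set\<close>

lemma valid_at_cong:
  assumes "\<And>s2. agree (X - Y) s s2 \<Longrightarrow> psat s2 \<phi> \<longleftrightarrow> psat s2 \<psi>"
  shows "valid_at X Y s \<phi> \<longleftrightarrow> valid_at X Y s \<psi>"
  unfolding valid_at_def using assms agree_compose by blast

lemma valid_at_trivial:
  assumes "\<And>s2. agree (X - Y) s s2 \<Longrightarrow> psat s2 \<phi>"
  shows "valid_at X Y s \<phi>"
  unfolding valid_at_def using assms agree_compose[of X s _ Y] agree_refl by blast

lemma valid_at_const:
  assumes "\<And>s2. agree (X - Y) s s2 \<Longrightarrow> psat s2 \<phi> \<longleftrightarrow> c"
  shows "valid_at X Y s \<phi> \<longleftrightarrow> c"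
  unfolding valid_at_def using assms agree_compose[of X s _ Y] agree_refl by blast

text \<open>The universal choice is made in two rounds, the variables of \<open>X' - X\<close> being
  settled in the first. Applied to fresh variables, it gives them fixed values.\<close>

lemma valid_at_extend:
  "X \<subseteq> X' \<Longrightarrow> valid_at X Y s \<phi> \<longleftrightarrow> (\<forall>s0. agree X s s0 \<longrightarrow> valid_at X' Y s0 \<phi>)"
  unfolding valid_at_def by (meson agree_mono agree_refl agree_trans)

lemma covered_cong:
  assumes "\<And>s2. agree (X - Y) s s2 \<Longrightarrow> (\<exists>e\<in>set S. esat s2 h e) \<longleftrightarrow> (\<exists>e\<in>set S'. esat s2 h' e)"
  shows "covered X Y s S h \<longleftrightarrow> covered X Y s S' h'"
  unfolding covered_def using assms by blast

lemma esat_agree: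
  "fv_pure (fst e) \<subseteq> X \<Longrightarrow> fv_spatial (snd e) \<subseteq> X \<Longrightarrow> agree X s s' \<Longrightarrow> esat s h e \<longleftrightarrow> esat s' h e"
  unfolding esat_def by (metis agree_mono ev_agree psat_agree)

text \<open>The family looks only at \<open>X\<close>, so a witness may be altered outside
  \<open>X\<close>; \<open>agree_splice\<close> makes it coincide there with any \<open>s1\<close>
  that extends \<open>s\<close> from \<open>X\<close>.\<close>

lemma covered_off_Y:
  assumes "\<forall>e\<in>set S. elem_ok X Y s e" and "agree X s s1"
  shows "covered X Y s S h \<longleftrightarrow> (\<exists>s2. agree (- Y) s1 s2 \<and> (\<exists>e\<in>set S. esat s2 h e))"
proof
  assume "covered X Y s S h"
  then obtain s2 e where *: "agree (X - Y) s s2" "e \<in> set S" "esat s2 h e"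
    by (auto simp: covered_def)
  then have "agree (X - Y) s1 s2"
    using assms(2) by (meson Diff_subset agree_mono agree_sym agree_trans)
  then obtain s3 where "agree (- Y) s1 s3" "agree X s2 s3"
    by (rule agree_splice)
  with * assms(1) show "\<exists>s2. agree (- Y) s1 s2 \<and> (\<exists>e\<in>set S. esat s2 h e)"
    unfolding elem_ok_def by (metis esat_agree)
next
  assume "\<exists>s2. agree (- Y) s1 s2 \<and> (\<exists>e\<in>set S. esat s2 h e)"
  then show "covered X Y s S h"
    unfolding covered_def using agree_compose[OF assms(2)] by blast
qed

lemma covered_extend:
  assumes "\<forall>e\<in>set S. elem_ok X Y s e" "\<forall>e\<in>set S. elem_ok X' Y s0 e" and "agree X s s0"
  shows "covered X' Y s0 S h \<longleftrightarrow> covered X Y s S h"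
  using covered_off_Y[OF assms(1,3)] covered_off_Y[OF assms(2) agree_refl] by simp

lemma lt_head_mono: "lt_head b L \<Longrightarrow> a \<le> b \<Longrightarrow> lt_head a L"
  by (induction a L rule: lt_head.induct) auto

lemma ssat_nonempty: "ssat h (ev s \<Sigma>) \<Longrightarrow> \<Sigma> \<noteq> [] \<Longrightarrow> hd \<Sigma> \<noteq> Emp \<Longrightarrow> h \<noteq> Map.empty"
  by (cases \<Sigma>; cases "hd \<Sigma>") auto

lemma left_okD:
  assumes "left_ok X Y s \<Pi> \<Sigma>" and "agree (X - Y) s s'"
  shows "psat s' \<Pi>" "ev s' \<Sigma> = ev s \<Sigma>"
  using assms unfolding left_ok_def by blast+

section \<open>Stripping the least cells from one disjunct\<close>

lemma head_ptE: "head_pt e \<Longrightarrow> (\<And>\<Pi> a w \<Sigma>. e = (\<Pi>, PointsTo a w # \<Sigma>) \<Longrightarrow> thesis) \<Longrightarrow> thesis"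
  by (metis head_pt_iff prod.collapse)

lemma head_arrE: "head_arr e \<Longrightarrow> (\<And>\<Pi> a b \<Sigma>. e = (\<Pi>, Arr a b # \<Sigma>) \<Longrightarrow> thesis) \<Longrightarrow> thesis"
  by (metis head_arr_iff prod.collapse)

text \<open>If the addresses differ, both sides fail: one by the added equation, the other because a
  satisfied head sits at the least address of \<open>h\<close>. If they coincide, the added
  sortedness conjunct follows from the satisfied rest.\<close>

lemma esat_match_pt:
  assumes "head_pt e" "h (ival s t) = Some v" "int v = ival s u" "\<forall>x\<in>dom h. ival s t \<le> x"
  shows "esat s (beyond h (ival s t)) (match_pt t u e) \<longleftrightarrow> esat s h e"
proof -
  obtain \<Pi>' a w \<Sigma>' where e: "e = (\<Pi>', PointsTo a w # \<Sigma>')"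
    using assms(1) by (rule head_ptE)
  show ?thesis
  proof (cases "ival s a = ival s t")
    case True
    have "lt_head (ival s t) (ev s \<Sigma>')" if "ssat (beyond h (ival s t)) (ev s \<Sigma>')"
      using that by (rule ssat_lt_head)
    with True assms(2-4) show ?thesis
      by (auto simp: e esat_def match_pt_def)
  next
    case False
    moreover have "ival s a = ival s t" if "ssat h (PointsTo (ival s a) (ival s w) # ev s \<Sigma>')"
    proof -
      have "ival s a \<in> dom h" "\<forall>x\<in>dom h. ival s a \<le> x" "ival s t \<in> dom h"
        using that assms(2) by auto
      then show ?thesis using assms(4) order_antisym by blast
    qed
    ultimately show ?thesis
      by (auto simp: e esat_def match_pt_def simp del: ssat.simps)
  qed
qed

lemma elem_ok_match_pt:
  assumes "head_pt e" "elem_ok X Y s e" "vars t \<subseteq> X" "vars u \<subseteq> X"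
  shows "elem_ok X Y s (match_pt t u e)"
proof -
  obtain \<Pi>' a w \<Sigma>' where e: "e = (\<Pi>', PointsTo a w # \<Sigma>')"
    using assms(1) by (rule head_ptE)
  show ?thesis
    using assms fv_below[of a \<Sigma>'] elem_ok_fv[of X Y s \<Pi>' \<Sigma>'] by (auto simp: e match_pt_def)
qed

text \<open>The effect of \<open>cut_arr\<close> on a single element; the flag \<open>c\<close>
  stands for membership of its position in \<open>J\<close>.\<close>

definition cut_elem ::
  "bool \<Rightarrow> dtm \<Rightarrow> dtm \<Rightarrow> dtm pure \<times> dtm spatial \<Rightarrow> dtm pure \<times> dtm spatial" where
  "cut_elem c t m e = (let ti = lo (hd (snd e)); ti' = hi (hd (snd e)) in
     if c then (PConj [fst e, PEq t ti, below (ti \<oplus> m) (tl (snd e))], tl (snd e))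
     else (PAnd (fst e) (PEq t ti), Arr (ti \<oplus> m \<oplus> num 1) ti' # tl (snd e)))"

lemma cut_arr_nth: "i < length S \<Longrightarrow> cut_arr J t m S ! i = cut_elem (i \<in> set J) t m (S ! i)"
  by (simp add: cut_arr_def cut_elem_def Let_def case_prod_unfold)

text \<open>Lengths are differences of end points, one less than the number of cells, so a cut of
  length \<open>m\<close> removes \<open>m + 1\<close> cells. An array of length exactly
  \<open>m\<close> disappears, a longer one is split after address \<open>t + m\<close>; with
  another starting address both sides are false.\<close>

lemma esat_cut_elem:
  assumes "head_arr e" "{ival s t..ival s t + ival s m} \<subseteq> dom h" "\<forall>x\<in>dom h. ival s t \<le> x"
    and "0 \<le> ival s m" "if c then ival s m = ival s (arr_len e) else ival s m < ival s (arr_len e)"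
  shows "esat s (beyond h (ival s t + ival s m)) (cut_elem c t m e) \<longleftrightarrow> esat s h e"
proof -
  obtain \<Pi>' a b \<Sigma>' where e: "e = (\<Pi>', Arr a b # \<Sigma>')"
    using assms(1) by (rule head_arrE)
  have "ival s t \<in> dom h"
    using subsetD[OF assms(2), of "ival s t"] assms(4) by simp
  then have eq: "ival s a = ival s t" if "ssat h (Arr (ival s a) (ival s b) # ev s \<Sigma>')"
    using that assms(3) by (meson atLeastAtMost_iff order_antisym order_refl ssat.simps(4) subsetD)
  show ?thesis
  proof (cases "ival s a = ival s t")
    case True
    show ?thesis
    proof (cases c)
      case c: True
      have "ival s b = ival s t + ival s m" using c assms(5) True by (simp add: e arr_len_def)
      then show ?thesis
        using assms c True by (auto simp: e esat_def cut_elem_def ssat_lt_head)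
    next
      case c: False
      have "ival s a \<le> ival s t + ival s m" "ival s t + ival s m < ival s b"
        using c assms(4,5) True by (simp_all add: e arr_len_def)
      then show ?thesis
        using assms c True
        by (simp add: e esat_def cut_elem_def ssat_Arr_split[of _ "ival s t + ival s m"] del: ssat.simps(4))
    qed
  next
    case False
    then show ?thesis
      using eq by (auto simp: e esat_def cut_elem_def simp del: ssat.simps(4))
  qed
qed

text \<open>A longer array keeps a nonnegative length because \<open>m\<close> is strictly smaller,
  and a constant one because \<open>m\<close> itself is constant.\<close>

lemma elem_ok_cut_elem:
  assumes "head_arr e" "elem_ok X Y s e" "vars t \<subseteq> X" "vars m \<subseteq> X"
    and "\<And>s'. agree (X - Y) s s' \<Longrightarrow> ival s' m = ival s m"
    and "\<not> c \<Longrightarrow> ival s m < ival s (arr_len e)"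
  shows "elem_ok X Y s (cut_elem c t m e)"
proof -
  obtain \<Pi>' a b \<Sigma>' where e: "e = (\<Pi>', Arr a b # \<Sigma>')"
    using assms(1) by (rule head_arrE)
  have *: "ival s' b - ival s' a = ival s b - ival s a" if "agree (X - Y) s s'" for s'
    using assms(2) that unfolding e elem_ok_simps arr_ok_def by blast
  have "ival s' b - ival s' (a \<oplus> m \<oplus> num 1) = ival s b - ival s (a \<oplus> m \<oplus> num 1)"
    if "agree (X - Y) s s'" for s'
    using *[OF that] assms(5)[OF that] by simp
  moreover have "\<not> c \<Longrightarrow> ival s (a \<oplus> m \<oplus> num 1) \<le> ival s b"
    using assms(6) by (simp add: e arr_len_def)
  ultimately have "\<not> c \<Longrightarrow> arr_ok X Y s (a \<oplus> m \<oplus> num 1) b"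
    unfolding arr_ok_def by blast
  moreover have "fv_pure (below (a \<oplus> m) \<Sigma>') \<subseteq> X"
    using fv_below[of "a \<oplus> m" \<Sigma>'] assms(2,4) elem_ok_fv[of X Y s \<Pi>' \<Sigma>'] by (auto simp: e)
  ultimately show ?thesis
    using assms(2-4) by (simp add: e cut_elem_def)
qed

lemma bex_cut_arr:
  assumes "\<And>i. i < length S \<Longrightarrow> esat s h' (cut_elem (i \<in> set J) t m (S ! i)) \<longleftrightarrow> esat s h (S ! i)"
  shows "(\<exists>e\<in>set (cut_arr J t m S). esat s h' e) \<longleftrightarrow> (\<exists>e\<in>set S. esat s h e)"
proof -
  have "(\<exists>e\<in>set (cut_arr J t m S). esat s h' e) \<longleftrightarrow>
    (\<exists>i<length S. esat s h' (cut_arr J t m S ! i))"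
    by (metis in_set_conv_nth length_cut_arr)
  also have "\<dots> \<longleftrightarrow> (\<exists>i<length S. esat s h (S ! i))"
    using assms cut_arr_nth by auto
  also have "\<dots> \<longleftrightarrow> (\<exists>e\<in>set S. esat s h e)"
    by (metis in_set_conv_nth)
  finally show ?thesis .
qed

section \<open>Sets of positions and the lengths of head arrays\<close>

lemma psat_shortest:
  "psat s (shortest J m S) \<longleftrightarrow>
    (\<forall>j\<in>set J. ival s m = ival s (arr_len (S ! j))) \<and>
    (\<forall>j<length S. j \<notin> set J \<longrightarrow> ival s m < ival s (arr_len (S ! j)))"
  by (auto simp: shortest_def)

text \<open>Subsets of positions are represented by sublists; this makes the representation unique,
  so that at most one \<open>J\<close> can have a true guard.\<close>

lemma subseqs_eqI:
  assumes "distinct xs" "J \<in> set (subseqs xs)" "K \<in> set (subseqs xs)" "set J = set K"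
  shows "J = K"
  using distinct_set_subseqs[OF assms(1)] assms(2-4) by (auto simp: distinct_map dest: inj_onD)

lemma filter_in_subseqs: "filter Q xs \<in> set (subseqs xs)"
  by (induction xs) (auto simp: Let_def)

lemma subseqs_set: "J \<in> set (subseqs xs) \<Longrightarrow> set J \<subseteq> set xs"
  using subseqs_powset[of xs] by blast

lemma arr_len_ok:
  assumes "head_arr e" "elem_ok X Y s e"
  shows "0 \<le> ival s (arr_len e)" "vars (arr_len e) \<subseteq> X"
    and "agree (X - Y) s s' \<Longrightarrow> ival s' (arr_len e) = ival s (arr_len e)"
proof -
  obtain \<Pi>' a b \<Sigma>' where e: "e = (\<Pi>', Arr a b # \<Sigma>')"
    using assms(1) by (rule head_arrE)
  have ok: "arr_ok X Y s a b" "vars a \<subseteq> X" "vars b \<subseteq> X"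
    using assms(2) by (simp_all add: e)
  have len: "arr_len e = DSub b a"
    by (simp add: e arr_len_def)
  show "0 \<le> ival s (arr_len e)"
    using ok(1) unfolding arr_ok_def len by (metis diff_ge_0_iff_ge ival.simps(3))
  show "vars (arr_len e) \<subseteq> X"
    using ok by (simp add: len)
  show "agree (X - Y) s s' \<Longrightarrow> ival s' (arr_len e) = ival s (arr_len e)"
    using ok(1) unfolding arr_ok_def len ival.simps by blast
qed

text \<open>Keeps equations \<open>ev s' \<Sigma> = ev s \<Sigma>\<close> usable as rewrite rules.\<close>

declare map_eq_conv [simp del]

lemma left_okI:
  assumes "fv_spatial \<Sigma> \<subseteq> X" "\<And>s'. agree (X - Y) s s' \<Longrightarrow> psat s' \<Pi> \<and> ev s' \<Sigma> = ev s \<Sigma>"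
    and "lt_head 0 (ev s \<Sigma>)" "conts_ok (ev s \<Sigma>)"
  shows "left_ok X Y s \<Pi> \<Sigma>"
  using assms unfolding left_ok_def by blast

lemma left_ok_base:
  assumes "left_ok X Y s \<Pi> \<Sigma>"
  shows "fv_spatial \<Sigma> \<subseteq> X" "lt_head 0 (ev s \<Sigma>)" "conts_ok (ev s \<Sigma>)"
  using assms unfolding left_ok_def by blast+

section \<open>Comparing heaps and disjuncts before and after a clause\<close>

abbreviation entails_at ::
  "nat set \<Rightarrow> nat set \<Rightarrow> store \<Rightarrow> int spatial \<Rightarrow> dtm family \<Rightarrow> bool" where
  "entails_at X Y s L S \<equiv> (\<forall>h. ssat h L \<longrightarrow> covered X Y s S h)"

text \<open>Restriction beyond \<open>b\<close> maps the heaps of \<open>L\<close> onto those of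
  \<open>L'\<close> and respects coverage. Surjectivity is what yields the implication from
  \<open>L\<close> to \<open>L'\<close>.\<close>

lemma entails_at_beyond:
  assumes "\<And>h. ssat h L \<Longrightarrow> ssat (beyond h b) L' \<and>
      (covered X Y s S' (beyond h b) \<longleftrightarrow> covered X Y s S h)"
    and "\<And>h'. ssat h' L' \<Longrightarrow> \<exists>h. ssat h L \<and> beyond h b = h'"
  shows "entails_at X Y s L S \<longleftrightarrow> entails_at X Y s L' S'"
  using assms by metis

lemma bex_middle: "(\<exists>e\<in>set (S1 @ e0 # S2). Q e) \<longleftrightarrow> Q e0 \<or> (\<exists>e\<in>set (S1 @ S2). Q e)"
  by auto

text \<open>Equivalence is asked at the single heap \<open>h\<close>, so the content of its least
  cell may be used when an array head is rewritten.\<close>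

lemma covered_change:
  assumes "\<And>s'. agree (X - Y) s s' \<Longrightarrow> esat s' h e \<longleftrightarrow> esat s' h e'"
  shows "covered X Y s (S1 @ e # S2) h \<longleftrightarrow> covered X Y s (S1 @ e' # S2) h"
  by (rule covered_cong) (simp only: bex_middle assms)

lemma covered_drop:
  assumes "\<And>s'. agree (X - Y) s s' \<Longrightarrow> \<not> esat s' h e"
  shows "covered X Y s (S1 @ e # S2) h \<longleftrightarrow> covered X Y s (S1 @ S2) h"
  by (rule covered_cong) (simp only: bex_middle assms simp_thms)

section \<open>Correctness of the individual clauses\<close>

lemma correct_EmpEmp:
  assumes "left_ok X Y s \<Pi> []" "\<forall>e\<in>set S. elem_ok X Y s e" "\<forall>e\<in>set S. snd e = []"
  shows "valid_at X Y s (PImp \<Pi> (PDisj (map fst S))) \<longleftrightarrow> entails_at X Y s [] S"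
proof -
  have "valid_at X Y s (PImp \<Pi> (PDisj (map fst S))) \<longleftrightarrow> valid_at X Y s (PDisj (map fst S))"
    by (rule valid_at_cong) (simp add: left_okD(1)[OF assms(1)])
  also have "\<dots> \<longleftrightarrow> (\<forall>s1. agree X s s1 \<longrightarrow>
      (\<exists>s2. agree (- Y) s1 s2 \<and> (\<exists>e\<in>set S. esat s2 Map.empty e)))"
    using assms(3) by (simp add: valid_at_def esat_def)
  also have "\<dots> \<longleftrightarrow> (\<forall>s1. agree X s s1 \<longrightarrow> covered X Y s S Map.empty)"
    using covered_off_Y[OF assms(2)] by simp
  also have "\<dots> \<longleftrightarrow> covered X Y s S Map.empty"
    using agree_refl by blast
  finally show ?thesis by simp
qed

text \<open>Nothing is covered by an empty family, so the left-hand side must have no heap; by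
  \<open>lsorted_ssat\<close> this means that it is not sorted.\<close>

lemma correct_empty:
  assumes "left_ok X Y s \<Pi> \<Sigma>"
  shows "valid_at X Y s (PNot (PAnd \<Pi> (sorted_sp \<Sigma>))) \<longleftrightarrow> entails_at X Y s (ev s \<Sigma>) []"
proof -
  have "valid_at X Y s (PNot (PAnd \<Pi> (sorted_sp \<Sigma>))) \<longleftrightarrow> \<not> lsorted (ev s \<Sigma>)"
  proof (rule valid_at_const)
    fix s2 assume "agree (X - Y) s s2"
    with left_okD[OF assms this] left_ok_base[OF assms]
    show "psat s2 (PNot (PAnd \<Pi> (sorted_sp \<Sigma>))) \<longleftrightarrow> \<not> lsorted (ev s \<Sigma>)"
      by (simp add: sorted_sp_def)
  qed
  also have "\<dots> \<longleftrightarrow> \<not> (\<exists>h. ssat h (ev s \<Sigma>))"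
    using assms lsorted_ssat ssat_lsorted unfolding left_ok_def by blast
  finally show ?thesis by (simp add: covered_def)
qed

lemma valid_at_guard_false:
  assumes "computes \<nu> X' \<Pi> \<Sigma> S \<phi>" "\<And>s'. agree (X - Y) s s' \<Longrightarrow> \<not> psat s' \<Pi>"
  shows "valid_at X Y s \<phi>"
  using assms computes_trivial valid_at_trivial by metis

text \<open>On a sorted left-hand side the least cell is stripped from every heap. The equations
  with \<open>t\<close> and \<open>u\<close> remain inside the disjuncts, where the existential
  variables may still be adjusted to satisfy them.\<close>

lemma correct_PtPt:
  assumes comp: "computes \<nu> X (PAnd \<Pi> (below t \<Sigma>)) \<Sigma> (map (match_pt t u) S) \<phi>"
    and IH: "left_ok X Y s (PAnd \<Pi> (below t \<Sigma>)) \<Sigma> \<Longrightarrow>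
      \<forall>e\<in>set (map (match_pt t u) S). elem_ok X Y s e \<Longrightarrow>
      valid_at X Y s \<phi> \<longleftrightarrow> entails_at X Y s (ev s \<Sigma>) (map (match_pt t u) S)"
    and left: "left_ok X Y s \<Pi> (PointsTo t u # \<Sigma>)"
    and S: "\<forall>e\<in>set S. elem_ok X Y s e" "\<forall>e\<in>set S. head_pt e"
  shows "valid_at X Y s \<phi> \<longleftrightarrow> entails_at X Y s (ev s (PointsTo t u # \<Sigma>)) S"
proof -
  define T U where "T = ival s t" and "U = ival s u"
  have const: "psat s' \<Pi>" "ival s' t = T" "ival s' u = U" "ev s' \<Sigma> = ev s \<Sigma>"
    if "agree (X - Y) s s'" for s'
    using left_okD[OF left that] by (simp_all add: T_def U_def)
  have fv: "vars t \<subseteq> X" "vars u \<subseteq> X" "fv_spatial \<Sigma> \<subseteq> X" and "0 < T" "0 \<le> U" "conts_ok (ev s \<Sigma>)"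
    using left_ok_base[OF left] by (auto simp: T_def U_def)
  show ?thesis
  proof (cases "lt_head T (ev s \<Sigma>)")
    case True
    have "valid_at X Y s \<phi> \<longleftrightarrow> entails_at X Y s (ev s \<Sigma>) (map (match_pt t u) S)"
    proof (rule IH)
      show "left_ok X Y s (PAnd \<Pi> (below t \<Sigma>)) \<Sigma>"
      proof (rule left_okI)
        fix s' assume "agree (X - Y) s s'"
        from const[OF this] True show "psat s' (PAnd \<Pi> (below t \<Sigma>)) \<and> ev s' \<Sigma> = ev s \<Sigma>"
          by simp
      qed (use fv \<open>0 < T\<close> \<open>conts_ok (ev s \<Sigma>)\<close> lt_head_mono[OF True, of 0] in simp_all)
      show "\<forall>e\<in>set (map (match_pt t u) S). elem_ok X Y s e"
        using S fv by (simp add: elem_ok_match_pt)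
    qed
    also have "\<dots> \<longleftrightarrow> entails_at X Y s (ev s (PointsTo t u # \<Sigma>)) S"
    proof (rule entails_at_beyond[symmetric, where b = T])
      fix h assume h: "ssat h (ev s (PointsTo t u # \<Sigma>))"
      then obtain v where v: "h T = Some v" "int v = U"
        by (auto simp: T_def U_def)
      have "esat s' (beyond h T) (match_pt t u e) \<longleftrightarrow> esat s' h e"
        if "agree (X - Y) s s'" "e \<in> set S" for s' e
        using esat_match_pt[of e h s' t v u] const[OF that(1)] S(2) that(2) v h by (simp add: T_def)
      then have "covered X Y s (map (match_pt t u) S) (beyond h T) \<longleftrightarrow> covered X Y s S h"
        by (intro covered_cong) simp
      with h show "ssat (beyond h T) (ev s \<Sigma>) \<and>
          (covered X Y s (map (match_pt t u) S) (beyond h T) \<longleftrightarrow> covered X Y s S h)"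
        by (simp add: T_def)
    next
      fix h' assume "ssat h' (ev s \<Sigma>)"
      \<comment> \<open>The left head prescribes the content; \<open>nat U\<close> represents it
        because contents are nonnegative.\<close>
      with True obtain h where "beyond h T = h'" "\<forall>x\<in>dom h. T \<le> x" "h T = Some (nat U)"
        by (metis extend_heap order_refl)
      with \<open>ssat h' (ev s \<Sigma>)\<close> \<open>0 \<le> U\<close>
      show "\<exists>h. ssat h (ev s (PointsTo t u # \<Sigma>)) \<and> beyond h T = h'"
        by (intro exI[of _ h]) (simp add: T_def U_def)
    qed
    finally show ?thesis .
  next
    \<comment> \<open>No heap satisfies the left-hand side, and the false guard makes
      \<open>\<phi>\<close> true.\<close>
    case False
    have "valid_at X Y s \<phi>"
    proof (rule valid_at_guard_false[OF comp])
      fix s' assume "agree (X - Y) s s'"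
      from const[OF this] False show "\<not> psat s' (PAnd \<Pi> (below t \<Sigma>))"
        by simp
    qed
    moreover have "\<not> ssat h (ev s (PointsTo t u # \<Sigma>))" for h
      using False ssat_lt_head by (auto simp: T_def)
    ultimately show ?thesis by blast
  qed
qed

text \<open>The addresses \<open>a\<close> and \<open>b\<close> may depend on \<open>Y\<close>, but
  their difference does not and is nonnegative. Hence the same one of the first two guards is true
  at all relevant stores, and the other conjuncts hold because their guards are false.\<close>

lemma correct_PtArr:
  assumes comp: "computes \<nu> X (PAnd \<Pi> (PEq b a)) (PointsTo t u # \<Sigma>)
        (S1 @ (\<Pi>', PointsTo a u # \<Sigma>') # S2) \<phi>1"
      "computes \<nu> X (PAnd \<Pi> (PLt a b)) (PointsTo t u # \<Sigma>)
        (S1 @ (\<Pi>', PointsTo a u # Arr (a \<oplus> num 1) b # \<Sigma>') # S2) \<phi>2"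
      "computes \<nu> X (PAnd \<Pi> (PLt b a)) (PointsTo t u # \<Sigma>) (S1 @ S2) \<phi>3"
    and IH1: "left_ok X Y s (PAnd \<Pi> (PEq b a)) (PointsTo t u # \<Sigma>) \<Longrightarrow>
      \<forall>e\<in>set (S1 @ (\<Pi>', PointsTo a u # \<Sigma>') # S2). elem_ok X Y s e \<Longrightarrow>
      valid_at X Y s \<phi>1 \<longleftrightarrow> entails_at X Y s (ev s (PointsTo t u # \<Sigma>))
        (S1 @ (\<Pi>', PointsTo a u # \<Sigma>') # S2)"
    and IH2: "left_ok X Y s (PAnd \<Pi> (PLt a b)) (PointsTo t u # \<Sigma>) \<Longrightarrow>
      \<forall>e\<in>set (S1 @ (\<Pi>', PointsTo a u # Arr (a \<oplus> num 1) b # \<Sigma>') # S2). elem_ok X Y s e \<Longrightarrow>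
      valid_at X Y s \<phi>2 \<longleftrightarrow> entails_at X Y s (ev s (PointsTo t u # \<Sigma>))
        (S1 @ (\<Pi>', PointsTo a u # Arr (a \<oplus> num 1) b # \<Sigma>') # S2)"
    and left: "left_ok X Y s \<Pi> (PointsTo t u # \<Sigma>)"
    and S: "\<forall>e\<in>set (S1 @ (\<Pi>', Arr a b # \<Sigma>') # S2). elem_ok X Y s e"
  shows "valid_at X Y s (PConj [\<phi>1, \<phi>2, \<phi>3]) \<longleftrightarrow>
    entails_at X Y s (ev s (PointsTo t u # \<Sigma>)) (S1 @ (\<Pi>', Arr a b # \<Sigma>') # S2)"
proof -
  define T U where "T = ival s t" and "U = ival s u"
  have const: "psat s' \<Pi>" "ival s' t = T" "ival s' u = U"
      "ev s' (PointsTo t u # \<Sigma>) = ev s (PointsTo t u # \<Sigma>)"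
    if "agree (X - Y) s s'" for s'
    using left_okD[OF left that] by (simp_all add: T_def U_def)
  have left': "fv_spatial (PointsTo t u # \<Sigma>) \<subseteq> X" "lt_head 0 (ev s (PointsTo t u # \<Sigma>))"
      "conts_ok (ev s (PointsTo t u # \<Sigma>))"
    using left_ok_base[OF left] by blast+
  have ab: "arr_ok X Y s a b" and ok: "vars a \<subseteq> X" "vars b \<subseteq> X" "elem_ok X Y s (\<Pi>', \<Sigma>')"
      "\<forall>e\<in>set (S1 @ S2). elem_ok X Y s e"
    using S by auto
  have len: "ival s' b - ival s' a = ival s b - ival s a" if "agree (X - Y) s s'" for s'
    using ab that unfolding arr_ok_def by blast
  have head: "\<exists>v. h T = Some v \<and> int v = U \<and> (\<forall>x\<in>dom h. T \<le> x)"
    if "ssat h (ev s (PointsTo t u # \<Sigma>))" for h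
    using that by (auto simp: T_def U_def)
  have "ival s a \<le> ival s b"
    using ab unfolding arr_ok_def by blast
  then consider "ival s b = ival s a" | "ival s a < ival s b"
    by linarith
  then show ?thesis
  proof cases
    case 1
    then have eq: "ival s' b = ival s' a" if "agree (X - Y) s s'" for s'
      using len[OF that] by simp
    have "valid_at X Y s (PConj [\<phi>1, \<phi>2, \<phi>3]) \<longleftrightarrow> valid_at X Y s \<phi>1"
    proof (rule valid_at_cong)
      fix s' assume "agree (X - Y) s s'"
      then show "psat s' (PConj [\<phi>1, \<phi>2, \<phi>3]) \<longleftrightarrow> psat s' \<phi>1"
        using eq[of s'] computes_trivial[OF comp(2), of s'] computes_trivial[OF comp(3), of s'] by simp
    qed
    also have "\<dots> \<longleftrightarrow> entails_at X Y s (ev s (PointsTo t u # \<Sigma>)) (S1 @ (\<Pi>', PointsTo a u # \<Sigma>') # S2)"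
    proof (rule IH1)
      show "left_ok X Y s (PAnd \<Pi> (PEq b a)) (PointsTo t u # \<Sigma>)"
      proof (rule left_okI)
        fix s' assume s': "agree (X - Y) s s'"
        show "psat s' (PAnd \<Pi> (PEq b a)) \<and> ev s' (PointsTo t u # \<Sigma>) = ev s (PointsTo t u # \<Sigma>)"
          using const(1,4)[OF s'] eq[OF s'] by simp
      qed (rule left')+
      show "\<forall>e\<in>set (S1 @ (\<Pi>', PointsTo a u # \<Sigma>') # S2). elem_ok X Y s e"
        using ok left'(1) by auto
    qed
    also have "\<dots> \<longleftrightarrow> entails_at X Y s (ev s (PointsTo t u # \<Sigma>)) (S1 @ (\<Pi>', Arr a b # \<Sigma>') # S2)"
    proof (intro all_cong imp_cong refl covered_change)
      fix h s' assume "ssat h (ev s (PointsTo t u # \<Sigma>))" and s': "agree (X - Y) s s'"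
      then obtain v where "h T = Some v" "int v = U" "\<forall>x\<in>dom h. T \<le> x"
        using head by blast
      then show "esat s' h (\<Pi>', PointsTo a u # \<Sigma>') \<longleftrightarrow> esat s' h (\<Pi>', Arr a b # \<Sigma>')"
        using const(3)[OF s'] eq[OF s'] ssat_Arr_single[of h T v "ival s' a"]
        by (simp add: esat_def del: ssat.simps)
    qed
    finally show ?thesis .
  next
    case 2
    then have less: "ival s' a < ival s' b" if "agree (X - Y) s s'" for s'
      using len[OF that] by simp
    have "valid_at X Y s (PConj [\<phi>1, \<phi>2, \<phi>3]) \<longleftrightarrow> valid_at X Y s \<phi>2"
    proof (rule valid_at_cong)
      fix s' assume "agree (X - Y) s s'"
      then show "psat s' (PConj [\<phi>1, \<phi>2, \<phi>3]) \<longleftrightarrow> psat s' \<phi>2"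
        using less[of s'] computes_trivial[OF comp(1), of s'] computes_trivial[OF comp(3), of s'] by simp
    qed
    also have "\<dots> \<longleftrightarrow> entails_at X Y s (ev s (PointsTo t u # \<Sigma>))
        (S1 @ (\<Pi>', PointsTo a u # Arr (a \<oplus> num 1) b # \<Sigma>') # S2)"
    proof (rule IH2)
      show "left_ok X Y s (PAnd \<Pi> (PLt a b)) (PointsTo t u # \<Sigma>)"
      proof (rule left_okI)
        fix s' assume s': "agree (X - Y) s s'"
        show "psat s' (PAnd \<Pi> (PLt a b)) \<and> ev s' (PointsTo t u # \<Sigma>) = ev s (PointsTo t u # \<Sigma>)"
          using const(1,4)[OF s'] less[OF s'] by simp
      qed (rule left')+
      have "ival s' b - ival s' (a \<oplus> num 1) = ival s b - ival s (a \<oplus> num 1)"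
        if "agree (X - Y) s s'" for s'
        using len[OF that] by simp
      moreover have "ival s (a \<oplus> num 1) \<le> ival s b"
        using 2 by simp
      ultimately have "arr_ok X Y s (a \<oplus> num 1) b"
        unfolding arr_ok_def by blast
      then show "\<forall>e\<in>set (S1 @ (\<Pi>', PointsTo a u # Arr (a \<oplus> num 1) b # \<Sigma>') # S2). elem_ok X Y s e"
        using ok left'(1) by auto
    qed
    also have "\<dots> \<longleftrightarrow> entails_at X Y s (ev s (PointsTo t u # \<Sigma>)) (S1 @ (\<Pi>', Arr a b # \<Sigma>') # S2)"
    proof (intro all_cong imp_cong refl covered_change)
      fix h s' assume "ssat h (ev s (PointsTo t u # \<Sigma>))" and s': "agree (X - Y) s s'"
      then obtain v where "h T = Some v" "int v = U" "\<forall>x\<in>dom h. T \<le> x"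
        using head by blast
      then show "esat s' h (\<Pi>', PointsTo a u # Arr (a \<oplus> num 1) b # \<Sigma>') \<longleftrightarrow>
          esat s' h (\<Pi>', Arr a b # \<Sigma>')"
        using const(3)[OF s'] less[OF s'] ssat_Arr_first[of h T v "ival s' a" "ival s' b"]
        by (simp add: esat_def del: ssat.simps)
    qed
    finally show ?thesis .
  qed
qed

text \<open>A store that agrees with \<open>s0\<close> on \<open>X' - Y\<close> agrees with
  \<open>s\<close> on \<open>X - Y\<close>, and end points of arrays have equal values in
  \<open>s\<close> and \<open>s0\<close> because their variables lie in \<open>X\<close>.\<close>

lemma elem_ok_extend:
  assumes "elem_ok X Y s e" "X \<subseteq> X'" "agree X s s0"
  shows "elem_ok X' Y s0 e"
proof -
  have s0: "agree (X - Y) s s'" if "agree (X' - Y) s0 s'" for s'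
    using that assms(2,3) by (auto simp: agree_def)
  have "arr_ok X' Y s0 a b" if "Arr a b \<in> set (snd e)" for a b
  proof -
    have ab: "arr_ok X Y s a b"
      using assms(1) that by (simp add: elem_ok_def)
    have "vars a \<union> vars b \<subseteq> fv_spatial (snd e)"
      using that by (force simp: fv_spatial_def)
    then have "vars a \<union> vars b \<subseteq> X"
      using assms(1) unfolding elem_ok_def by blast
    then have "ival s0 a = ival s a" "ival s0 b = ival s b"
      using agree_sym[OF assms(3)] by (auto intro!: ival_agree elim: agree_mono)
    with ab s0 show ?thesis
      unfolding arr_ok_def by metis
  qed
  with assms(1,2) show ?thesis
    unfolding elem_ok_def by blast
qed

text \<open>An array imposes nothing on the content of its first cell, so its heaps are the union,
  over all \<open>v\<close>, of those whose first cell contains \<open>v\<close>. The universal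
  choice of the fresh variable runs through exactly these \<open>v\<close>.\<close>

lemma correct_ArrPt:
  assumes comp: "computes \<nu> X' (PAnd \<Pi> (PLt t t')) (PointsTo t (var z) # Arr (t \<oplus> num 1) t' # \<Sigma>) S \<phi>1"
      "computes \<nu> X' (PAnd \<Pi> (PEq t' t)) (PointsTo t (var z') # \<Sigma>) S \<phi>2"
    and X': "X' = insert z' (insert z X)" "z \<notin> X" "z' \<notin> X" "Y \<subseteq> X"
    and IH1: "\<And>s. left_ok X' Y s (PAnd \<Pi> (PLt t t')) (PointsTo t (var z) # Arr (t \<oplus> num 1) t' # \<Sigma>) \<Longrightarrow>
      \<forall>e\<in>set S. elem_ok X' Y s e \<Longrightarrow> valid_at X' Y s \<phi>1 \<longleftrightarrow>
      entails_at X' Y s (ev s (PointsTo t (var z) # Arr (t \<oplus> num 1) t' # \<Sigma>)) S"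
    and IH2: "\<And>s. left_ok X' Y s (PAnd \<Pi> (PEq t' t)) (PointsTo t (var z') # \<Sigma>) \<Longrightarrow>
      \<forall>e\<in>set S. elem_ok X' Y s e \<Longrightarrow> valid_at X' Y s \<phi>2 \<longleftrightarrow>
      entails_at X' Y s (ev s (PointsTo t (var z') # \<Sigma>)) S"
    and left: "left_ok X Y s \<Pi> (Arr t t' # \<Sigma>)"
    and S: "\<forall>e\<in>set S. elem_ok X Y s e"
  shows "valid_at X Y s (PAnd \<phi>1 \<phi>2) \<longleftrightarrow> entails_at X Y s (ev s (Arr t t' # \<Sigma>)) S"
proof -
  define T T' where "T = ival s t" and "T' = ival s t'"
  have const: "psat s' \<Pi>" "ival s' t = T" "ival s' t' = T'" "ev s' \<Sigma> = ev s \<Sigma>"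
    if "agree (X - Y) s s'" for s'
    using left_okD[OF left that] by (simp_all add: T_def T'_def)
  have fv: "vars t \<subseteq> X" "vars t' \<subseteq> X" "fv_spatial \<Sigma> \<subseteq> X" and "0 < T" "conts_ok (ev s \<Sigma>)"
    using left_ok_base[OF left] by (auto simp: T_def)
  have sub: "X \<subseteq> X'"
    using X' by blast
  have ext: "agree (X - Y) s s'" if "agree X s s0" "agree (X' - Y) s0 s'" for s0 s'
    using that sub by (auto simp: agree_def)
  have fresh: "s' z = s0 z" "s' z' = s0 z'" if "agree (X' - Y) s0 s'" for s0 s'
  proof -
    \<comment> \<open>Since \<open>Y \<subseteq> X\<close>, fresh variables are not existential;
      once chosen, they are fixed on the left.\<close>
    have "z \<in> X' - Y" "z' \<in> X' - Y"
      using X' by auto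
    with that show "s' z = s0 z" "s' z' = s0 z'"
      unfolding agree_def by metis+
  qed
  have S0: "\<forall>e\<in>set S. elem_ok X' Y s0 e" if "agree X s s0" for s0
    using S elem_ok_extend[OF _ sub that] by blast
  have cov: "covered X' Y s0 S h \<longleftrightarrow> covered X Y s S h" if "agree X s s0" for s0 h
    using covered_extend[OF S S0 that] that by blast
  have self: "agree (X - Y) s s0" if "agree X s s0" for s0
    using that by (auto simp: agree_def)
  have choose: "\<exists>s0. agree X s s0 \<and> s0 x = v" if "x \<notin> X" for x v
    using that by (intro exI[of _ "s(x := v)"]) (auto simp: agree_def)
  consider "T' < T" | "T' = T" | "T < T'"
    by linarith
  then show ?thesis
  proof cases
    case 1
    \<comment> \<open>An array with reversed bounds has no heap, and neither guard is true.\<close>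
    have "valid_at X Y s (PAnd \<phi>1 \<phi>2)"
    proof (rule valid_at_trivial)
      fix s' assume "agree (X - Y) s s'"
      from const[OF this] 1 show "psat s' (PAnd \<phi>1 \<phi>2)"
        using computes_trivial[OF comp(1), of s'] computes_trivial[OF comp(2), of s'] by simp
    qed
    moreover have "\<not> ssat h (ev s (Arr t t' # \<Sigma>))" for h
      using 1 by (simp add: T_def T'_def)
    ultimately show ?thesis by blast
  next
    case 2
    have "valid_at X Y s (PAnd \<phi>1 \<phi>2) \<longleftrightarrow> valid_at X Y s \<phi>2"
    proof (rule valid_at_cong)
      fix s' assume "agree (X - Y) s s'"
      from const[OF this] 2 show "psat s' (PAnd \<phi>1 \<phi>2) \<longleftrightarrow> psat s' \<phi>2"
        using computes_trivial[OF comp(1), of s'] by simp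
    qed
    also have "\<dots> \<longleftrightarrow> (\<forall>s0. agree X s s0 \<longrightarrow> valid_at X' Y s0 \<phi>2)"
      by (rule valid_at_extend[OF sub])
    also have "\<dots> \<longleftrightarrow> (\<forall>s0. agree X s s0 \<longrightarrow>
        entails_at X Y s (PointsTo T (int (s0 z')) # ev s \<Sigma>) S)"
    proof (intro all_cong imp_cong refl)
      fix s0 assume s0: "agree X s s0"
      have "left_ok X' Y s0 (PAnd \<Pi> (PEq t' t)) (PointsTo t (var z') # \<Sigma>)"
      proof (rule left_okI)
        fix s' assume s': "agree (X' - Y) s0 s'"
        show "psat s' (PAnd \<Pi> (PEq t' t)) \<and>
            ev s' (PointsTo t (var z') # \<Sigma>) = ev s0 (PointsTo t (var z') # \<Sigma>)"
          using const[OF ext[OF s0 s']] const[OF self[OF s0]] fresh[OF s'] 2 by simp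
      qed (use fv sub X' const[OF self[OF s0]] \<open>0 < T\<close> \<open>conts_ok (ev s \<Sigma>)\<close> in auto)
      from IH2[OF this S0[OF s0]] cov[OF s0] const[OF self[OF s0]]
      show "valid_at X' Y s0 \<phi>2 \<longleftrightarrow> entails_at X Y s (PointsTo T (int (s0 z')) # ev s \<Sigma>) S"
        by simp
    qed
    \<comment> \<open>Among the stores that agree with \<open>s\<close> on \<open>X\<close>, the
      value of \<open>z'\<close> is an arbitrary natural number; contents of heaps are natural as
      well.\<close>
    also have "\<dots> \<longleftrightarrow> (\<forall>v. entails_at X Y s (PointsTo T (int v) # ev s \<Sigma>) S)"
      using choose[OF X'(3)] by metis
    also have "\<dots> \<longleftrightarrow> entails_at X Y s (Arr T T # ev s \<Sigma>) S"
    proof -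
      have "ssat h (Arr T T # ev s \<Sigma>) \<longleftrightarrow> (\<exists>v. ssat h (PointsTo T (int v) # ev s \<Sigma>))" for h
        by (auto simp: dom_def)
      then show ?thesis by blast
    qed
    finally show ?thesis
      using 2 by (simp add: T_def T'_def del: ssat.simps)
  next
    case 3
    have "valid_at X Y s (PAnd \<phi>1 \<phi>2) \<longleftrightarrow> valid_at X Y s \<phi>1"
    proof (rule valid_at_cong)
      fix s' assume "agree (X - Y) s s'"
      from const[OF this] 3 show "psat s' (PAnd \<phi>1 \<phi>2) \<longleftrightarrow> psat s' \<phi>1"
        using computes_trivial[OF comp(2), of s'] by simp
    qed
    also have "\<dots> \<longleftrightarrow> (\<forall>s0. agree X s s0 \<longrightarrow> valid_at X' Y s0 \<phi>1)"
      by (rule valid_at_extend[OF sub])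
    also have "\<dots> \<longleftrightarrow> (\<forall>s0. agree X s s0 \<longrightarrow>
        entails_at X Y s (PointsTo T (int (s0 z)) # Arr (T + 1) T' # ev s \<Sigma>) S)"
    proof (intro all_cong imp_cong refl)
      fix s0 assume s0: "agree X s s0"
      have "left_ok X' Y s0 (PAnd \<Pi> (PLt t t')) (PointsTo t (var z) # Arr (t \<oplus> num 1) t' # \<Sigma>)"
      proof (rule left_okI)
        fix s' assume s': "agree (X' - Y) s0 s'"
        show "psat s' (PAnd \<Pi> (PLt t t')) \<and>
            ev s' (PointsTo t (var z) # Arr (t \<oplus> num 1) t' # \<Sigma>) = ev s0 (PointsTo t (var z) # Arr (t \<oplus> num 1) t' # \<Sigma>)"
          using const[OF ext[OF s0 s']] const[OF self[OF s0]] fresh[OF s'] 3 by simp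
      qed (use fv sub X' const[OF self[OF s0]] \<open>0 < T\<close> \<open>conts_ok (ev s \<Sigma>)\<close> in auto)
      from IH1[OF this S0[OF s0]] cov[OF s0] const[OF self[OF s0]]
      show "valid_at X' Y s0 \<phi>1 \<longleftrightarrow>
          entails_at X Y s (PointsTo T (int (s0 z)) # Arr (T + 1) T' # ev s \<Sigma>) S"
        by simp
    qed
    also have "\<dots> \<longleftrightarrow> (\<forall>v. entails_at X Y s (PointsTo T (int v) # Arr (T + 1) T' # ev s \<Sigma>) S)"
      using choose[OF X'(2)] by metis
    also have "\<dots> \<longleftrightarrow> entails_at X Y s (Arr T T' # ev s \<Sigma>) S"
    proof -
      have "ssat h (Arr T T' # ev s \<Sigma>) \<longleftrightarrow>
          (\<exists>v. ssat h (PointsTo T (int v) # Arr (T + 1) T' # ev s \<Sigma>))" for h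
        unfolding ssat_Arr_split[OF order_refl 3] ssat.simps(3) by (auto simp: dom_def)
      then show ?thesis by blast
    qed
    finally show ?thesis
      by (simp add: T_def T'_def del: ssat.simps)
  qed
qed

text \<open>Shared by both halves of the clause for two arrays: \<open>\<Sigma>'\<close> is what
  remains on the left after \<open>m + 1\<close> cells, either the atoms after the array or the
  shortened array followed by them. \<open>split\<close> describes the removal, and
  \<open>below\<close> allows it to be undone.\<close>

lemma correct_cut:
  assumes IH: "left_ok X Y s \<Pi>' \<Sigma>' \<Longrightarrow> \<forall>e\<in>set (cut_arr J t m S). elem_ok X Y s e \<Longrightarrow>
      valid_at X Y s \<phi> \<longleftrightarrow> entails_at X Y s (ev s \<Sigma>') (cut_arr J t m S)"
    and left: "left_ok X Y s \<Pi> (Arr t t' # \<Sigma>)" "left_ok X Y s \<Pi>' \<Sigma>'"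
    and S: "\<forall>e\<in>set S. elem_ok X Y s e" "\<forall>e\<in>set S. head_arr e"
    and m: "vars m \<subseteq> X" "0 \<le> ival s m" "\<And>s'. agree (X - Y) s s' \<Longrightarrow> ival s' m = ival s m"
    and J: "\<And>i. i < length S \<Longrightarrow>
      if i \<in> set J then ival s m = ival s (arr_len (S ! i)) else ival s m < ival s (arr_len (S ! i))"
    and split: "\<And>h. ssat h (ev s (Arr t t' # \<Sigma>)) \<longleftrightarrow>
      {ival s t..ival s t + ival s m} \<subseteq> dom h \<and> (\<forall>x\<in>dom h. ival s t \<le> x) \<and>
      ssat (beyond h (ival s t + ival s m)) (ev s \<Sigma>')"
    and below: "lt_head (ival s t + ival s m) (ev s \<Sigma>')"
  shows "valid_at X Y s \<phi> \<longleftrightarrow> entails_at X Y s (ev s (Arr t t' # \<Sigma>)) S"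
proof -
  have t: "vars t \<subseteq> X"
    using left_ok_base[OF left(1)] by simp
  have t_const: "ival s' t = ival s t" if "agree (X - Y) s s'" for s'
    using left_okD(2)[OF left(1) that] by simp
  have "elem_ok X Y s (cut_arr J t m S ! i)" if "i < length S" for i
    unfolding cut_arr_nth[OF that]
  proof (rule elem_ok_cut_elem)
    show "head_arr (S ! i)" "elem_ok X Y s (S ! i)"
      using S that by simp_all
    show "i \<notin> set J \<Longrightarrow> ival s m < ival s (arr_len (S ! i))"
      using J[OF that] by simp
  qed (use t m in blast)+
  then have "\<forall>e\<in>set (cut_arr J t m S). elem_ok X Y s e"
    by (metis in_set_conv_nth length_cut_arr)
  with IH left(2) have "valid_at X Y s \<phi> \<longleftrightarrow> entails_at X Y s (ev s \<Sigma>') (cut_arr J t m S)"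
    by blast
  also have "\<dots> \<longleftrightarrow> entails_at X Y s (ev s (Arr t t' # \<Sigma>)) S"
  proof (rule entails_at_beyond[symmetric, where b = "ival s t + ival s m"])
    fix h assume h: "ssat h (ev s (Arr t t' # \<Sigma>))"
    have "(\<exists>e\<in>set (cut_arr J t m S). esat s' (beyond h (ival s t + ival s m)) e) \<longleftrightarrow>
        (\<exists>e\<in>set S. esat s' h e)" if s': "agree (X - Y) s s'" for s'
    proof (rule bex_cut_arr)
      fix i assume i: "i < length S"
      then have e: "head_arr (S ! i)" "elem_ok X Y s (S ! i)"
        using S by simp_all
      show "esat s' (beyond h (ival s t + ival s m)) (cut_elem (i \<in> set J) t m (S ! i)) \<longleftrightarrow>
          esat s' h (S ! i)"
        using esat_cut_elem[of "S ! i" s' t m h "i \<in> set J"] e(1) J[OF i] h m(2)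
        unfolding split t_const[OF s'] m(3)[OF s'] arr_len_ok(3)[OF e s'] by blast
    qed
    then have "covered X Y s (cut_arr J t m S) (beyond h (ival s t + ival s m)) \<longleftrightarrow> covered X Y s S h"
      by (rule covered_cong)
    with h show "ssat (beyond h (ival s t + ival s m)) (ev s \<Sigma>') \<and>
        (covered X Y s (cut_arr J t m S) (beyond h (ival s t + ival s m)) \<longleftrightarrow> covered X Y s S h)"
      unfolding split by blast
  next
    fix h' assume h': "ssat h' (ev s \<Sigma>')"
    \<comment> \<open>The added cells belong to an array, so any content will do.\<close>
    obtain h where "beyond h (ival s t + ival s m) = h'"
        "{ival s t..ival s t + ival s m} \<subseteq> dom h" "\<forall>x\<in>dom h. ival s t \<le> x"
      using extend_heap[OF h' below, of "ival s t"] m(2) by auto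
    with h' show "\<exists>h. ssat h (ev s (Arr t t' # \<Sigma>)) \<and> beyond h (ival s t + ival s m) = h'"
      unfolding split by blast
  qed
  finally show ?thesis .
qed

text \<open>The comparison of the left length with the least right length singles out one conjunct:
  some \<open>F J\<close> if the left array is nowhere longer, some \<open>G J\<close> otherwise.
  Its \<open>J\<close> collects the positions whose length equals the length of the cut.\<close>

lemma correct_ArrArr:
  fixes S m
  defines "I \<equiv> subseqs [0..<length S]"
  assumes m: "m = DSub t' t"
    and m': "\<And>J. J \<in> set I \<Longrightarrow> J \<noteq> [] \<Longrightarrow> m' J = arr_len (S ! hd J)"
    and compF: "\<And>J. J \<in> set I \<Longrightarrow>
      computes \<nu> X (PConj [\<Pi>, shortest J m S, PLe t t', below t' \<Sigma>]) \<Sigma> (cut_arr J t m S) (F J)"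
    and compG: "\<And>J. J \<in> set I \<Longrightarrow> J \<noteq> [] \<Longrightarrow>
      computes \<nu> X (PConj [\<Pi>, PLt (m' J) m, shortest J (m' J) S])
        (Arr (t \<oplus> m' J \<oplus> num 1) t' # \<Sigma>) (cut_arr J t (m' J) S) (G J)"
    and IHF: "\<And>J. J \<in> set I \<Longrightarrow>
      left_ok X Y s (PConj [\<Pi>, shortest J m S, PLe t t', below t' \<Sigma>]) \<Sigma> \<Longrightarrow>
      \<forall>e\<in>set (cut_arr J t m S). elem_ok X Y s e \<Longrightarrow>
      valid_at X Y s (F J) \<longleftrightarrow> entails_at X Y s (ev s \<Sigma>) (cut_arr J t m S)"
    and IHG: "\<And>J. J \<in> set I \<Longrightarrow> J \<noteq> [] \<Longrightarrow>
      left_ok X Y s (PConj [\<Pi>, PLt (m' J) m, shortest J (m' J) S]) (Arr (t \<oplus> m' J \<oplus> num 1) t' # \<Sigma>) \<Longrightarrow>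
      \<forall>e\<in>set (cut_arr J t (m' J) S). elem_ok X Y s e \<Longrightarrow>
      valid_at X Y s (G J) \<longleftrightarrow>
        entails_at X Y s (ev s (Arr (t \<oplus> m' J \<oplus> num 1) t' # \<Sigma>)) (cut_arr J t (m' J) S)"
    and left: "left_ok X Y s \<Pi> (Arr t t' # \<Sigma>)"
    and S: "\<forall>e\<in>set S. elem_ok X Y s e" "\<forall>e\<in>set S. head_arr e"
  shows "valid_at X Y s (PAnd (PConj (map F I)) (PConj (map G (filter (\<lambda>J. J \<noteq> []) I)))) \<longleftrightarrow>
    entails_at X Y s (ev s (Arr t t' # \<Sigma>)) S"
proof -
  let ?\<phi> = "PAnd (PConj (map F I)) (PConj (map G (filter (\<lambda>J. J \<noteq> []) I)))"
  define T T' k where "T = ival s t" and "T' = ival s t'" and "k i = ival s (arr_len (S ! i))" for i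
  have const: "psat s' \<Pi>" "ival s' t = T" "ival s' t' = T'" "ev s' \<Sigma> = ev s \<Sigma>"
    if "agree (X - Y) s s'" for s'
    using left_okD[OF left that] by (simp_all add: T_def T'_def)
  have fv: "vars t \<subseteq> X" "vars t' \<subseteq> X" "fv_spatial \<Sigma> \<subseteq> X" and "0 < T" "conts_ok (ev s \<Sigma>)"
    using left_ok_base[OF left] by (auto simp: T_def)
  have len: "0 \<le> k i" "vars (arr_len (S ! i)) \<subseteq> X" if "i < length S" for i
    using arr_len_ok(1,2)[of "S ! i" X Y s] S that by (simp_all add: k_def)
  have len_const: "ival s' (arr_len (S ! i)) = k i" if "i < length S" "agree (X - Y) s s'" for i s'
    using arr_len_ok(3)[of "S ! i" X Y s s'] S that by (simp add: k_def)
  have m_const: "ival s' m = T' - T" if "agree (X - Y) s s'" for s'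
    using const[OF that] by (simp add: m)
  have IJ: "set J \<subseteq> {..<length S}" if "J \<in> set I" for J
    using subseqs_set[of J "[0..<length S]"] that by (auto simp: I_def)
  have hd_less: "hd J < length S" if "J \<in> set I" "J \<noteq> []" for J
    using IJ[OF that(1)] that(2) by (cases J) auto
  have m'_const: "ival s' (m' J) = k (hd J)" if "J \<in> set I" "J \<noteq> []" "agree (X - Y) s s'" for s' J
    using len_const[OF hd_less[OF that(1,2)] that(3)] m'[OF that(1,2)] by simp
  define is_short where "is_short c J \<longleftrightarrow> (\<forall>i<length S. if i \<in> set J then c = k i else c < k i)" for c J
  have short: "psat s' (shortest J c S) \<longleftrightarrow> is_short (ival s' c) J"
    if "J \<in> set I" "agree (X - Y) s s'" for s' J c
  proof -
    have "\<forall>i\<in>set J. i < length S"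
      using IJ[OF that(1)] by blast
    then show ?thesis
      unfolding psat_shortest is_short_def using len_const[OF _ that(2)] by auto
  qed
  \<comment> \<open>The only candidate for a true guard with cut length \<open>c\<close>; its guard
    is indeed true once \<open>c\<close> is a lower bound of the lengths.\<close>
  define Jc where "Jc c = filter (\<lambda>i. c = k i) [0..<length S]" for c
  have Jc: "Jc c \<in> set I" for c
    by (simp add: Jc_def I_def filter_in_subseqs)
  have short_unique: "J = Jc c" if "is_short c J" "J \<in> set I" for c J
  proof (rule subseqs_eqI)
    show "distinct [0..<length S]" "J \<in> set (subseqs [0..<length S])"
        "Jc c \<in> set (subseqs [0..<length S])"
      using that(2) Jc by (simp_all add: I_def)
    show "set J = set (Jc c)"
    proof (rule set_eqI)
      fix i
      show "i \<in> set J \<longleftrightarrow> i \<in> set (Jc c)"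
      proof -
        have "i \<in> set (Jc c) \<longleftrightarrow> i < length S \<and> c = k i"
          by (simp add: Jc_def)
        then show ?thesis
          using that(1) IJ[OF that(2)] unfolding is_short_def
          by (metis lessThan_iff order_less_irrefl subsetD)
      qed
    qed
  qed
  have short_Jc: "is_short c (Jc c)" if "\<forall>i<length S. c \<le> k i" for c
    using that unfolding is_short_def Jc_def by (auto simp: order_le_less)
  have F_trivial: "psat s' (F J)"
    if "J \<in> set I" "agree (X - Y) s s'" "\<not> (T \<le> T' \<and> is_short (T' - T) J)" for J s'
    using that const[OF that(2)] m_const[OF that(2)] short[OF that(1,2), of m]
    by (intro computes_trivial[OF compF[OF that(1)]]) auto
  have G_trivial: "psat s' (G J)"
    if "J \<in> set I" "J \<noteq> []" "agree (X - Y) s s'"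
      "\<not> (k (hd J) < T' - T \<and> is_short (k (hd J)) J)" for J s'
    using that m_const[OF that(3)] m'_const[OF that(1-3)] short[OF that(1,3), of "m' J"]
    by (intro computes_trivial[OF compG[OF that(1,2)]]) auto
  have \<phi>_iff: "psat s' ?\<phi> \<longleftrightarrow> (\<forall>J\<in>set I. psat s' (F J)) \<and> (\<forall>J\<in>set I. J \<noteq> [] \<longrightarrow> psat s' (G J))" for s'
    by auto
  \<comment> \<open>The left array has reversed bounds, is at most as long as every right array, or
    is longer than some right array.\<close>
  consider "T' < T" | "T \<le> T'" "\<forall>i<length S. T' - T \<le> k i" | "\<exists>i<length S. k i < T' - T" "T \<le> T'"
    by force
  then show ?thesis
  proof cases
    case 1
    have "valid_at X Y s ?\<phi>"
    proof (rule valid_at_trivial)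
      fix s' assume s': "agree (X - Y) s s'"
      have "psat s' (G J)" if "J \<in> set I" "J \<noteq> []" for J
        using G_trivial[OF that s'] len(1)[OF hd_less[OF that]] 1 by linarith
      moreover have "psat s' (F J)" if "J \<in> set I" for J
        using F_trivial[OF that s'] 1 by linarith
      ultimately show "psat s' ?\<phi>"
        unfolding \<phi>_iff by blast
    qed
    moreover have "\<not> ssat h (ev s (Arr t t' # \<Sigma>))" for h
      using 1 by (simp add: T_def T'_def)
    ultimately show ?thesis by blast
  next
    case 2
    define J where "J = Jc (T' - T)"
    have J: "J \<in> set I" "is_short (T' - T) J"
      using Jc short_Jc[OF 2(2)] by (simp_all add: J_def)
    have "valid_at X Y s ?\<phi> \<longleftrightarrow> valid_at X Y s (F J)"
    proof (rule valid_at_cong)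
      fix s' assume s': "agree (X - Y) s s'"
      have "psat s' (G K)" if "K \<in> set I" "K \<noteq> []" for K
        using G_trivial[OF that s'] 2(2) hd_less[OF that] by force
      moreover have "psat s' (F K)" if "K \<in> set I" "K \<noteq> J" for K
        using F_trivial[OF that(1) s'] short_unique[of "T' - T" K] that by (auto simp: J_def)
      ultimately show "psat s' ?\<phi> \<longleftrightarrow> psat s' (F J)"
        unfolding \<phi>_iff using J(1) by blast
    qed
    also have "\<dots> \<longleftrightarrow> entails_at X Y s (ev s (Arr t t' # \<Sigma>)) S"
    \<comment> \<open>The whole left array is consumed here, so the atoms after it must start above
      \<open>T'\<close>; otherwise the left-hand side has no heap and the guard is false.\<close>
    proof (cases "lt_head T' (ev s \<Sigma>)")
      case True
      have sum: "ival s t + ival s m = T'"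
        using m_const[of s] by (simp add: T_def)
      show ?thesis
      proof (rule correct_cut[OF IHF[OF J(1)] left _ S], assumption+)
        show "left_ok X Y s (PConj [\<Pi>, shortest J m S, PLe t t', below t' \<Sigma>]) \<Sigma>"
        proof (rule left_okI)
          fix s' assume s': "agree (X - Y) s s'"
          show "psat s' (PConj [\<Pi>, shortest J m S, PLe t t', below t' \<Sigma>]) \<and> ev s' \<Sigma> = ev s \<Sigma>"
            using const[OF s'] m_const[OF s'] short[OF J(1) s', of m] J(2) 2(1) True by simp
        qed (use fv \<open>0 < T\<close> 2(1) lt_head_mono[OF True, of 0] \<open>conts_ok (ev s \<Sigma>)\<close> in simp_all)
        show "vars m \<subseteq> X" "0 \<le> ival s m"
          using fv m_const[of s] 2(1) by (simp_all add: m)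
        show "ival s' m = ival s m" if "agree (X - Y) s s'" for s'
          using m_const[OF that] m_const[of s] by simp
        show "if i \<in> set J then ival s m = ival s (arr_len (S ! i)) else ival s m < ival s (arr_len (S ! i))"
          if "i < length S" for i
        proof -
          have "if i \<in> set J then T' - T = k i else T' - T < k i"
            using J(2) that unfolding is_short_def by blast
          then show ?thesis
            using m_const[of s] by (cases "i \<in> set J") (simp_all add: k_def)
        qed
        show "ssat h (ev s (Arr t t' # \<Sigma>)) \<longleftrightarrow>
            {ival s t..ival s t + ival s m} \<subseteq> dom h \<and> (\<forall>x\<in>dom h. ival s t \<le> x) \<and>
            ssat (beyond h (ival s t + ival s m)) (ev s \<Sigma>)" for h
          unfolding sum using 2(1) by (simp add: T_def T'_def)
        show "lt_head (ival s t + ival s m) (ev s \<Sigma>)"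
          unfolding sum by (rule True)
      qed
    next
      case False
      have "valid_at X Y s (F J)"
      proof (rule valid_at_guard_false[OF compF[OF J(1)]])
        fix s' assume s': "agree (X - Y) s s'"
        show "\<not> psat s' (PConj [\<Pi>, shortest J m S, PLe t t', below t' \<Sigma>])"
          using const[OF s'] False by simp
      qed
      moreover have "\<not> ssat h (ev s (Arr t t' # \<Sigma>))" for h
        using False ssat_lt_head by (auto simp: T'_def)
      ultimately show ?thesis by blast
    qed
    finally show ?thesis .
  next
    case 3
    define c where "c = Min (k ` {..<length S})"
    have "c \<in> k ` {..<length S}" and c_le: "\<forall>i<length S. c \<le> k i"
      using 3(1) unfolding c_def by (auto intro!: Min_in)
    then have "\<exists>i<length S. c = k i"
      by auto
    define J where "J = Jc c"
    have J: "J \<in> set I" "is_short c J"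
      using Jc short_Jc[OF c_le] by (simp_all add: J_def)
    \<comment> \<open>The minimum is attained. Nonemptiness matters because the cut length is read
      off at the position \<open>hd J\<close>.\<close>
    have "J \<noteq> []"
      using \<open>\<exists>i<length S. c = k i\<close> by (auto simp: J_def Jc_def filter_empty_conv)
    have hd: "k (hd J) = c"
      using J(2) hd_less[OF J(1) \<open>J \<noteq> []\<close>] \<open>J \<noteq> []\<close> by (auto simp: is_short_def)
    have c: "0 \<le> c" "c < T' - T"
      using 3 c_le len(1) \<open>\<exists>i<length S. c = k i\<close> by force+
    \<comment> \<open>A true \<open>shortest\<close> guard for \<open>K\<close> makes its own length
      a lower bound of all lengths, hence equal to the minimum; uniqueness then gives
      \<open>K = J\<close>.\<close>
    have G_min: "k (hd K) = c" if "K \<in> set I" "K \<noteq> []" "is_short (k (hd K)) K" for K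
    proof (rule order_antisym)
      show "c \<le> k (hd K)"
        using c_le hd_less[OF that(1,2)] by blast
      obtain i where "i < length S" "c = k i"
        using \<open>\<exists>i<length S. c = k i\<close> by blast
      with that(3) show "k (hd K) \<le> c"
        unfolding is_short_def by (metis order_le_less)
    qed
    have "valid_at X Y s ?\<phi> \<longleftrightarrow> valid_at X Y s (G J)"
    proof (rule valid_at_cong)
      fix s' assume s': "agree (X - Y) s s'"
      have "psat s' (G K)" if "K \<in> set I" "K \<noteq> []" "K \<noteq> J" for K
        using G_trivial[OF that(1,2) s'] G_min[OF that(1,2)] short_unique[of c K] that
        by (auto simp: J_def)
      moreover have "psat s' (F K)" if "K \<in> set I" for K
      proof (rule F_trivial[OF that s'])
        obtain i where "i < length S" "k i < T' - T"
          using 3(1) by blast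
        then show "\<not> (T \<le> T' \<and> is_short (T' - T) K)"
          unfolding is_short_def by (metis order_less_asym order_less_irrefl)
      qed
      ultimately show "psat s' ?\<phi> \<longleftrightarrow> psat s' (G J)"
        unfolding \<phi>_iff using J(1) \<open>J \<noteq> []\<close> by blast
    qed
    also have "\<dots> \<longleftrightarrow> entails_at X Y s (ev s (Arr t t' # \<Sigma>)) S"
    proof -
      note m'J = m'_const[OF J(1) \<open>J \<noteq> []\<close>, unfolded hd]
      have ev_J: "ev s (Arr (t \<oplus> m' J \<oplus> num 1) t' # \<Sigma>) = Arr (T + c + 1) T' # ev s \<Sigma>"
        using m'J[of s] by (simp add: T_def T'_def)
      show ?thesis
      proof (rule correct_cut[OF IHG[OF J(1) \<open>J \<noteq> []\<close>] left _ S], assumption+)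
        show "left_ok X Y s (PConj [\<Pi>, PLt (m' J) m, shortest J (m' J) S]) (Arr (t \<oplus> m' J \<oplus> num 1) t' # \<Sigma>)"
        proof (rule left_okI)
          fix s' assume s': "agree (X - Y) s s'"
          have "ev s' (Arr (t \<oplus> m' J \<oplus> num 1) t' # \<Sigma>) = Arr (T + c + 1) T' # ev s \<Sigma>"
            using const[OF s'] m'J[OF s'] by simp
          moreover have "psat s' (PConj [\<Pi>, PLt (m' J) m, shortest J (m' J) S])"
            using const[OF s'] m_const[OF s'] m'J[OF s'] short[OF J(1) s', of "m' J"] J(2) c by simp
          ultimately show "psat s' (PConj [\<Pi>, PLt (m' J) m, shortest J (m' J) S]) \<and>
              ev s' (Arr (t \<oplus> m' J \<oplus> num 1) t' # \<Sigma>) = ev s (Arr (t \<oplus> m' J \<oplus> num 1) t' # \<Sigma>)"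
            unfolding ev_J by blast
        next
          show "fv_spatial (Arr (t \<oplus> m' J \<oplus> num 1) t' # \<Sigma>) \<subseteq> X"
            using fv m'[OF J(1) \<open>J \<noteq> []\<close>] len(2)[OF hd_less[OF J(1) \<open>J \<noteq> []\<close>]] by simp
          show "lt_head 0 (ev s (Arr (t \<oplus> m' J \<oplus> num 1) t' # \<Sigma>))"
              "conts_ok (ev s (Arr (t \<oplus> m' J \<oplus> num 1) t' # \<Sigma>))"
            unfolding ev_J using \<open>0 < T\<close> c \<open>conts_ok (ev s \<Sigma>)\<close> by simp_all
        qed
        show "vars (m' J) \<subseteq> X" "0 \<le> ival s (m' J)"
          using m'J[of s] c m'[OF J(1) \<open>J \<noteq> []\<close>] len(2)[OF hd_less[OF J(1) \<open>J \<noteq> []\<close>]] by simp_all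
        show "ival s' (m' J) = ival s (m' J)" if "agree (X - Y) s s'" for s'
          using m'J[OF that] m'J[of s] by simp
        show "if i \<in> set J then ival s (m' J) = ival s (arr_len (S ! i))
            else ival s (m' J) < ival s (arr_len (S ! i))"
          if "i < length S" for i
        proof -
          have "if i \<in> set J then c = k i else c < k i"
            using J(2) that unfolding is_short_def by blast
          then show ?thesis
            using m'J[of s] by (cases "i \<in> set J") (simp_all add: k_def)
        qed
        show "ssat h (ev s (Arr t t' # \<Sigma>)) \<longleftrightarrow>
            {ival s t..ival s t + ival s (m' J)} \<subseteq> dom h \<and> (\<forall>x\<in>dom h. ival s t \<le> x) \<and>
            ssat (beyond h (ival s t + ival s (m' J))) (ev s (Arr (t \<oplus> m' J \<oplus> num 1) t' # \<Sigma>))" for h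
          unfolding ev_J using ssat_Arr_split[of T "T + c" T' h "ev s \<Sigma>"] c m'J[of s]
          by (simp add: T_def T'_def del: ssat.simps)
        show "lt_head (ival s t + ival s (m' J)) (ev s (Arr (t \<oplus> m' J \<oplus> num 1) t' # \<Sigma>))"
          unfolding ev_J using m'J[of s] by (simp add: T_def)
      qed
    qed
    finally show ?thesis .
  qed
qed

text \<open>The store is generalised because the clause with fresh variables uses the induction
  hypothesis at every store that agrees with \<open>s\<close> on \<open>X\<close>, one for each
  value of the fresh variable.\<close>

theorem transl_correct:
  assumes "computes \<nu> X \<Pi> \<Sigma> S \<phi>" and fresh: "\<And>Z. finite Z \<Longrightarrow> \<nu> Z \<notin> Z"
    and "finite X" "Y \<subseteq> X" "left_ok X Y s \<Pi> \<Sigma>" "\<forall>e\<in>set S. elem_ok X Y s e"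
  shows "valid_at X Y s \<phi> \<longleftrightarrow> entails_at X Y s (ev s \<Sigma>) S"
  using assms(1,3-)
proof (induction arbitrary: s rule: computes.induct)
  case (EmpL X \<Pi> \<Sigma> S \<phi>)
  have "left_ok X Y s \<Pi> \<Sigma>"
  proof (rule left_okI)
    fix s' assume "agree (X - Y) s s'"
    from left_okD[OF EmpL.prems(3) this] show "psat s' \<Pi> \<and> ev s' \<Sigma> = ev s \<Sigma>"
      by simp
  qed (use left_ok_base[OF EmpL.prems(3)] in simp_all)
  with EmpL show ?case by simp
next
  case (EmpR X \<Pi> \<Sigma> S1 \<Pi>' \<Sigma>' S2 \<phi>)
  have "covered X Y s (S1 @ (\<Pi>', \<Sigma>') # S2) h \<longleftrightarrow> covered X Y s (S1 @ (\<Pi>', Emp # \<Sigma>') # S2) h" for h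
    by (rule covered_change) (simp add: esat_def)
  moreover have "\<forall>e\<in>set (S1 @ (\<Pi>', \<Sigma>') # S2). elem_ok X Y s e"
    using EmpR.prems(4) by auto
  ultimately show ?case
    using EmpR by simp
next
  case (EmpNEmp \<Sigma>' X \<Pi> S1 S2 \<phi> \<Pi>')
  have "covered X Y s (S1 @ (\<Pi>', \<Sigma>') # S2) Map.empty \<longleftrightarrow> covered X Y s (S1 @ S2) Map.empty"
    using EmpNEmp.hyps(1,2) ssat_nonempty by (intro covered_drop) (auto simp: esat_def)
  then show ?case
    using EmpNEmp by simp
next
  case (EmpEmp S X \<Pi>)
  then show ?case using correct_EmpEmp by simp
next
  case (NEmpEmp \<Sigma> X \<Pi> S1 S2 \<phi> \<Pi>')
  have "covered X Y s (S1 @ (\<Pi>', []) # S2) h \<longleftrightarrow> covered X Y s (S1 @ S2) h"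
    if "ssat h (ev s \<Sigma>)" for h
    using NEmpEmp.hyps(1,2) ssat_nonempty that by (intro covered_drop) (auto simp: esat_def)
  then show ?case
    using NEmpEmp by simp
next
  case (empty X \<Pi> \<Sigma>)
  then show ?case using correct_empty by simp
next
  case (PtPt S X \<Pi> t \<Sigma> u \<phi>)
  show ?case
    by (rule correct_PtPt[OF PtPt.hyps(2) PtPt.IH PtPt.prems(3,4) PtPt.hyps(1)])
      (use PtPt.prems in simp_all)
next
  case (PtArr X \<Pi> b a t u \<Sigma> S1 \<Pi>' \<Sigma>' S2 \<phi>1 \<phi>2 \<phi>3)
  show ?case
    by (rule correct_PtArr[OF PtArr.hyps(1-3) PtArr.IH(1,2) PtArr.prems(3,4)])
      (use PtArr.prems in simp_all)
next
  case (ArrPt z X z' X' \<Pi> t t' \<Sigma> S \<phi>1 \<phi>2)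
  have X': "z \<notin> X" "z' \<notin> X" "finite X'" "Y \<subseteq> X'"
    using fresh[of X] fresh[of "insert z X"] ArrPt.hyps(1-3) ArrPt.prems(1,2) by auto
  show ?case
    by (rule correct_ArrPt[OF ArrPt.hyps(4,5,3) X'(1,2) ArrPt.prems(2) ArrPt.IH ArrPt.prems(3,4)])
      (use X' in simp_all)
next
  case (ArrArr S m t' t X \<Pi> \<Sigma> F m' G)
  show ?case
    by (rule correct_ArrArr[where \<nu> = \<nu>])
      (use ArrArr.hyps ArrArr.IH ArrArr.prems in simp_all)
qed

section \<open>Transfer to the assertion language\<close>

abbreviation tev :: "store \<Rightarrow> tm spatial \<Rightarrow> int spatial" where
  "tev s \<Sigma> \<equiv> map (map_atom (\<lambda>t. int (val s t))) \<Sigma>"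

definition lift :: "heap \<Rightarrow> iheap" where
  "lift h x = (if x < 0 then None else h (nat x))"

lemma ev_map_Tm: "ev s (map (map_atom Tm) \<Sigma>) = tev s \<Sigma>"
  by (simp add: atom.map_comp comp_def)

lemma dom_lift: "dom (lift h) = int ` dom h"
proof (rule set_eqI)
  fix x
  show "x \<in> dom (lift h) \<longleftrightarrow> x \<in> int ` dom h"
    by (cases x rule: int_cases2) (auto simp: lift_def image_iff dom_def)
qed

lemma lift_restrict: "lift (h |` {b<..}) = beyond (lift h) (int b)"
  by (rule ext) (auto simp: lift_def restrict_map_def)

lemma sat_below [simp]: "sat_pure s (below t \<Sigma>) \<longleftrightarrow> lt_head (int (val s t)) (tev s \<Sigma>)"
  by (induction t \<Sigma> rule: below.induct) auto

lemma sat_sorted' [simp]: "sat_pure s (sorted' \<Sigma>) \<longleftrightarrow> lsorted (tev s \<Sigma>)"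
  by (induction \<Sigma> rule: sorted'.induct) auto

text \<open>If the first part owns \<open>{a..b}\<close> and the second lies above \<open>b\<close>,
  both are determined as restrictions of \<open>h\<close>. Here the existential over splittings
  disappears.\<close>

lemma heap_split:
  fixes h :: heap
  assumes "a \<le> b" and "\<And>h. Q h \<Longrightarrow> dom h = {a..b}"
  shows "(\<exists>h1 h2. dom h1 \<inter> dom h2 = {} \<and> h = h1 ++ h2 \<and> Q h1 \<and> R h2 \<and> (\<forall>x\<in>dom h2. b < x)) \<longleftrightarrow>
    (\<forall>x\<in>dom h. a \<le> x) \<and> Q (h |` {a..b}) \<and> R (h |` {b<..})"
proof
  assume "\<exists>h1 h2. dom h1 \<inter> dom h2 = {} \<and> h = h1 ++ h2 \<and> Q h1 \<and> R h2 \<and> (\<forall>x\<in>dom h2. b < x)"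
  then obtain h1 h2 where h: "h = h1 ++ h2" and *: "Q h1" "R h2" "\<forall>x\<in>dom h2. b < x"
    by blast
  have dom1: "x \<in> dom h1 \<longleftrightarrow> a \<le> x \<and> x \<le> b" for x
    using assms(2)[OF *(1)] by auto
  have dom2: "h2 x = Some v \<Longrightarrow> b < x" for x v
    using *(3) by blast
  have "h |` {a..b} = h1"
  proof
    fix x
    show "(h |` {a..b}) x = h1 x"
      using dom1[of x] dom2[of x]
      by (cases "h1 x"; cases "h2 x") (auto simp: h restrict_map_def map_add_def)
  qed
  moreover have "h |` {b<..} = h2"
  proof
    fix x
    show "(h |` {b<..}) x = h2 x"
      using dom1[of x] dom2[of x]
      by (cases "h1 x"; cases "h2 x") (auto simp: h restrict_map_def map_add_def)
  qed
  moreover have "\<forall>x\<in>dom h. a \<le> x"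
    using dom1 *(3) assms(1) unfolding h dom_map_add by (meson Un_iff le_trans less_imp_le_nat)
  ultimately show "(\<forall>x\<in>dom h. a \<le> x) \<and> Q (h |` {a..b}) \<and> R (h |` {b<..})"
    using * by simp
next
  assume *: "(\<forall>x\<in>dom h. a \<le> x) \<and> Q (h |` {a..b}) \<and> R (h |` {b<..})"
  have "h = h |` {a..b} ++ h |` {b<..}"
  proof
    fix x
    show "h x = (h |` {a..b} ++ h |` {b<..}) x"
      using * by (cases "h x") (force simp: restrict_map_def map_add_def)+
  qed
  moreover have "dom (h |` {a..b}) \<inter> dom (h |` {b<..}) = {}" "\<forall>x\<in>dom (h |` {b<..}). b < x"
    by auto
  ultimately show "\<exists>h1 h2. dom h1 \<inter> dom h2 = {} \<and> h = h1 ++ h2 \<and> Q h1 \<and> R h2 \<and> (\<forall>x\<in>dom h2. b < x)"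
    using * by blast
qed

text \<open>Sortedness provides the side condition of \<open>heap_split\<close>: the part owned by
  the remaining atoms lies above the last address of the head.\<close>

lemma sat_sorted_iff: "lsorted (tev s \<Sigma>) \<and> sat_spatial s h \<Sigma> \<longleftrightarrow> ssat (lift h) (tev s \<Sigma>)"
proof (induction \<Sigma> arbitrary: h)
  case Nil
  have "lift h = Map.empty \<longleftrightarrow> dom h = {}"
    using dom_lift[of h] by auto
  then show ?case by simp
next
  case (Cons a \<Sigma>)
  \<comment> \<open>The induction hypothesis makes \<open>lt_head_iff\<close> applicable, which
    turns the test on the next atom into a bound on the domain of \<open>h2\<close>.\<close>
  have lt: "lsorted (tev s \<Sigma>) \<and> lt_head (int b) (tev s \<Sigma>) \<and> sat_spatial s h2 \<Sigma> \<longleftrightarrow>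
      ssat (lift h2) (tev s \<Sigma>) \<and> (\<forall>x\<in>dom h2. b < x)" for b h2
    using Cons[of h2] lt_head_iff[of "lift h2" "tev s \<Sigma>" "int b"] by (auto simp: dom_lift)
  show ?case
  proof (cases a)
    case Emp
    have "sat_spatial s h (Emp # \<Sigma>) \<longleftrightarrow> sat_spatial s h \<Sigma>"
      by auto
    with Cons[of h] show ?thesis
      unfolding Emp list.map atom.map lsorted.simps ssat.simps by blast
  next
    case (PointsTo t u)
    define T where "T = val s t"
    have "lsorted (tev s (a # \<Sigma>)) \<and> sat_spatial s h (a # \<Sigma>) \<longleftrightarrow>
      (\<exists>h1 h2. dom h1 \<inter> dom h2 = {} \<and> h = h1 ++ h2 \<and> (dom h1 = {T..T} \<and> h1 T = Some (val s u)) \<and>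
        lsorted (tev s \<Sigma>) \<and> lt_head (int T) (tev s \<Sigma>) \<and> sat_spatial s h2 \<Sigma>)"
      unfolding PointsTo list.map atom.map lsorted.simps sat_spatial.simps sat_atom.simps
        atLeastAtMost_singleton T_def by blast
    also have "\<dots> \<longleftrightarrow>
      (\<exists>h1 h2. dom h1 \<inter> dom h2 = {} \<and> h = h1 ++ h2 \<and> (dom h1 = {T..T} \<and> h1 T = Some (val s u)) \<and>
        ssat (lift h2) (tev s \<Sigma>) \<and> (\<forall>x\<in>dom h2. T < x))"
      unfolding lt ..
    also have "\<dots> \<longleftrightarrow> (\<forall>x\<in>dom h. T \<le> x) \<and>
        (dom (h |` {T..T}) = {T..T} \<and> (h |` {T..T}) T = Some (val s u)) \<and>
        ssat (lift (h |` {T<..})) (tev s \<Sigma>)"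
      by (rule heap_split) auto
    also have "\<dots> \<longleftrightarrow> ssat (lift h) (tev s (a # \<Sigma>))"
      by (auto simp: PointsTo lift_restrict dom_lift simp flip: T_def) (auto simp: lift_def)
    finally show ?thesis .
  next
    case (Arr t u)
    define T U where "T = val s t" and "U = val s u"
    show ?thesis
    proof (cases "T \<le> U")
      case True
      have "lsorted (tev s (a # \<Sigma>)) \<and> sat_spatial s h (a # \<Sigma>) \<longleftrightarrow>
        (\<exists>h1 h2. dom h1 \<inter> dom h2 = {} \<and> h = h1 ++ h2 \<and> dom h1 = {T..U} \<and>
          lsorted (tev s \<Sigma>) \<and> lt_head (int U) (tev s \<Sigma>) \<and> sat_spatial s h2 \<Sigma>)"
        using True unfolding Arr list.map atom.map lsorted.simps sat_spatial.simps sat_atom.simps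
          T_def U_def of_nat_le_iff by blast
      also have "\<dots> \<longleftrightarrow>
        (\<exists>h1 h2. dom h1 \<inter> dom h2 = {} \<and> h = h1 ++ h2 \<and> dom h1 = {T..U} \<and>
          ssat (lift h2) (tev s \<Sigma>) \<and> (\<forall>x\<in>dom h2. U < x))"
        unfolding lt ..
      also have "\<dots> \<longleftrightarrow> (\<forall>x\<in>dom h. T \<le> x) \<and> dom (h |` {T..U}) = {T..U} \<and>
          ssat (lift (h |` {U<..})) (tev s \<Sigma>)"
        using True by (rule heap_split)
      also have "dom (h |` {T..U}) = {T..U} \<longleftrightarrow> {int T..int U} \<subseteq> dom (lift h)"
      proof -
        have "{int T..int U} = int ` {T..U}"
          by (simp add: image_int_atLeastAtMost)
        then show ?thesis
          by (auto simp: dom_lift inj_image_subset_iff)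
      qed
      finally show ?thesis
        using True by (auto simp: Arr lift_restrict dom_lift simp flip: T_def U_def)
    next
      case False
      then show ?thesis
        by (simp add: Arr T_def U_def)
    qed
  qed
qed

lemma ssat_finite: "ssat h L \<Longrightarrow> finite (dom h)"
proof (induction h L rule: ssat.induct)
  case (3 h a v L)
  have "dom h \<subseteq> insert a (dom (beyond h a))"
    using 3(2) by force
  with 3 show ?case
    by (metis finite_insert finite_subset ssat.simps(3))
next
  case (4 h a b L)
  have "dom h \<subseteq> {a..b} \<union> dom (beyond h b)"
    using 4(2) by force
  with 4 show ?case
    by (metis finite_Un finite_atLeastAtMost_int finite_subset ssat.simps(4))
qed auto

text \<open>Integer heaps may be infinite or have nonpositive addresses. A list bounds the domain to
  finitely many cells, and a positive start makes them positive, so \<open>H\<close> stems from a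
  genuine heap.\<close>

lemma ssat_is_lift:
  assumes "ssat H L" "lt_head 0 L"
  obtains h where "is_heap h" "lift h = H"
proof
  have pos: "\<forall>x\<in>dom H. 0 < x"
    using assms lt_head_iff by blast
  show "lift (H \<circ> int) = H"
  proof
    fix x
    show "lift (H \<circ> int) x = H x"
    proof (cases "x < 0")
      case True
      then have "x \<notin> dom H"
        using pos order_less_asym by blast
      then have "H x = None"
        by blast
      with True show ?thesis
        by (simp add: lift_def)
    qed (simp add: lift_def)
  qed
  then have "dom H = int ` dom (H \<circ> int)"
    by (metis dom_lift)
  then have "finite (dom (H \<circ> int))" "0 \<notin> dom (H \<circ> int)"
    using ssat_finite[OF assms(1)] pos by (auto dest: finite_imageD)
  then show "is_heap (H \<circ> int)"
    by (simp add: is_heap_def)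
qed

lemma sat_tilde:
  "sat s h (tilde \<Sigma>) \<longleftrightarrow> lt_head 0 (tev s \<Sigma>) \<and> ssat (lift h) (tev s \<Sigma>)"
  using sat_sorted_iff[of s \<Sigma> h] by (auto simp: tilde_def sorted_sp_def)

text \<open>Since 0 is not a location, the conjunct \<open>0 < \<Sigma>\<close> is automatic on a
  genuine heap.\<close>

lemma sat_tilde_heap:
  assumes "is_heap h"
  shows "sat s h (tilde \<Sigma>) \<longleftrightarrow> ssat (lift h) (tev s \<Sigma>)"
proof -
  have "0 < n" if "n \<in> dom h" for n
    using assms that by (metis gr_zeroI is_heap_def)
  then have "\<forall>x\<in>dom (lift h). 0 < x"
    by (simp add: dom_lift)
  then show ?thesis
    using lt_head_iff[of "lift h" "tev s \<Sigma>" 0] unfolding sat_tilde by blast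
qed

section \<open>Coincidence and quantifier prefixes for assertions\<close>

lemma sat_atom_agree: "agree (\<Union>t\<in>set_atom a. vars t) s s' \<Longrightarrow> sat_atom s h a \<longleftrightarrow> sat_atom s' h a"
proof (cases a)
  case (PointsTo t u)
  assume "agree (\<Union>t\<in>set_atom a. vars t) s s'"
  then have "agree (vars t) s s'" "agree (vars u) s s'"
    by (auto simp: PointsTo agree_def)
  then show ?thesis by (simp add: PointsTo val_agree)
next
  case (Arr t u)
  assume "agree (\<Union>t\<in>set_atom a. vars t) s s'"
  then have "agree (vars t) s s'" "agree (vars u) s s'"
    by (auto simp: Arr agree_def)
  then show ?thesis by (simp add: Arr val_agree)
qed simp

lemma sat_spatial_agree:
  "agree (fv_spatial \<Sigma>) s s' \<Longrightarrow> sat_spatial s h \<Sigma> \<longleftrightarrow> sat_spatial s' h \<Sigma>"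
proof (induction \<Sigma> arbitrary: h)
  case (Cons a \<Sigma>)
  then have "agree (\<Union>t\<in>set_atom a. vars t) s s'" "agree (fv_spatial \<Sigma>) s s'"
    by (auto simp: agree_def fv_spatial_def)
  then show ?case
    using Cons.IH sat_atom_agree by simp
qed simp

lemma sat_agree: "agree (fv f) s s' \<Longrightarrow> sat s h f \<longleftrightarrow> sat s' h f"
proof (induction f arbitrary: s s')
  case (FAnd f g)
  then have "agree (fv f) s s'" "agree (fv g) s s'" by (auto simp: agree_def)
  then show ?case using FAnd.IH[of s s'] by simp
next
  case (FEx x f)
  then have "agree (fv f) (s(x := n)) (s'(x := n))" for n by (simp add: agree_upd)
  then show ?case using FEx.IH by (metis sat.simps(5))
qed (simp_all add: sat_pure_agree sat_spatial_agree)

text \<open>Lets a block of existential quantifiers be read as a single change of store, for pure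
  formulas and for assertions alike. The witness for \<open>x\<close> is its value in the final
  store.\<close>

lemma ex_agree_Cons:
  "(\<exists>n s'. agree (- set xs) (s(x := n)) s' \<and> Q s') \<longleftrightarrow> (\<exists>s'. agree (- set (x # xs)) s s' \<and> Q s')"
proof safe
  fix s' assume *: "agree (- set (x # xs)) s s'" "Q s'"
  then have "agree (- set xs) (s(x := s' x)) s'"
    by (auto simp: agree_def)
  with * show "\<exists>n s'. agree (- set xs) (s(x := n)) s' \<and> Q s'"
    by blast
next
  fix n s' assume *: "agree (- set xs) (s(x := n)) s'" "Q s'"
  have "s z = s' z" if "z \<noteq> x" "z \<notin> set xs" for z
    using *(1) that unfolding agree_def by (metis ComplI fun_upd_other)
  then have "agree (- set (x # xs)) s s'"
    by (simp add: agree_def)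
  with * show "\<exists>s'. agree (- set (x # xs)) s s' \<and> Q s'"
    by blast
qed

lemma agree_UNIV: "agree UNIV s s' \<longleftrightarrow> s = s'"
  by (auto simp: agree_def)

lemma sat_foldr_PEx:
  "sat_pure s (foldr PEx xs p) \<longleftrightarrow> (\<exists>s'. agree (- set xs) s s' \<and> sat_pure s' p)"
proof (induction xs arbitrary: s)
  case (Cons x xs)
  show ?case
    unfolding foldr.simps o_apply sat_pure.simps Cons by (rule ex_agree_Cons)
qed (simp add: agree_UNIV)

lemma sat_foldr_FEx:
  "sat s h (foldr FEx xs f) \<longleftrightarrow> (\<exists>s'. agree (- set xs) s s' \<and> sat s' h f)"
proof (induction xs arbitrary: s)
  case (Cons x xs)
  show ?case
    unfolding foldr.simps o_apply sat.simps Cons by (rule ex_agree_Cons)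
qed (simp add: agree_UNIV)

text \<open>Validity quantifies over all stores already and so absorbs a universal prefix.\<close>

lemma sat_foldr_PAll: "(\<forall>s. sat_pure s (foldr PAll xs p)) \<longleftrightarrow> (\<forall>s. sat_pure s p)"
proof (induction xs)
  case (Cons x xs)
  have "(\<forall>s. sat_pure s (PAll x q)) \<longleftrightarrow> (\<forall>s. sat_pure s q)" for q
  proof -
    have "sat_pure s (PAll x q) \<longleftrightarrow> (\<forall>n. sat_pure (s(x := n)) q)" for s
      by (simp add: PAll_def)
    then show ?thesis by (metis fun_upd_triv)
  qed
  with Cons show ?case by simp
qed simp

lemma valid_Pure: "valid (Pure p) \<longleftrightarrow> (\<forall>s. sat_pure s p)"
proof -
  have "is_heap Map.empty" by (simp add: is_heap_def)
  then show ?thesis by (auto simp: valid_def)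
qed

lemma sat_FDisj: "sat s h (FDisj fs) \<longleftrightarrow> (\<exists>f\<in>set fs. sat s h f)"
  by (induction fs) (simp_all add: FDisj_def FOr_def)

lemma fv_FDisj: "fv (FDisj fs) = (\<Union>f\<in>set fs. fv f)"
  by (induction fs) (simp_all add: FDisj_def FOr_def)

lemma fv_foldr_FEx: "fv (foldr FEx xs f) = fv f - set xs"
  by (induction xs) auto

lemma fv_spatial_map_Tm: "fv_spatial (map (map_atom Tm) \<Sigma>) = fv_spatial \<Sigma>"
  by (simp add: fv_spatial_def atom.set_map)

theorem theorem1:
  fixes \<Pi> :: "tm pure" and \<Sigma> :: "tm spatial"
    and I :: "'i::linorder set"
    and \<Pi>s :: "'i \<Rightarrow> tm pure" and \<Sigma>s :: "'i \<Rightarrow> tm spatial" and ys :: "'i \<Rightarrow> nat list"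
    and y zs :: "nat list" and V X :: "nat set" and \<nu> :: "nat set \<Rightarrow> nat"
    and lhs rhs :: form and \<phi> :: "tm pure"
  assumes "finite I"
    and y: "y = concat (map ys (sorted_list_of_set I))"
    and V: "V = fv_pure \<Pi> \<union> fv_spatial \<Sigma> \<union> (\<Union>i\<in>I. fv_pure (\<Pi>s i) \<union> fv_spatial (\<Sigma>s i))"
    and lhs: "lhs = FAnd (Pure \<Pi>) (tilde \<Sigma>)"
    and rhs: "rhs = FDisj (map (\<lambda>i. foldr FEx (ys i) (FAnd (Pure (\<Pi>s i)) (tilde (\<Sigma>s i))))
                       (sorted_list_of_set I))"
    and bound_vars: "set y \<inter> (fv lhs \<union> fv rhs) = {}"
    and fresh: "\<And>Y. finite Y \<Longrightarrow> \<nu> Y \<notin> Y"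
    and X: "finite X" "V \<union> set y \<subseteq> X"
    and \<phi>: "\<phi> = P \<nu> X \<Pi> \<Sigma> (map (\<lambda>i. (\<Pi>s i, \<Sigma>s i)) (sorted_list_of_set I))"
    and zs: "zs = sorted_list_of_set (fv_pure \<phi> - V)"
    and arrays: "\<And>i t t'. i \<in> I \<Longrightarrow> Arr t t' \<in> set (\<Sigma>s i) \<Longrightarrow>
                   \<exists>u. t' = Add t u \<and> vars u \<inter> set y = {}"
  shows "lhs \<TTurnstile> rhs \<longleftrightarrow> valid (Pure (foldr PAll zs (foldr PEx y \<phi>)))"
proof -
  define \<Sigma>' where "\<Sigma>' = map (map_atom Tm) \<Sigma>"
  define \<Pi>0 where "\<Pi>0 = PAnd (map_pure Tm \<Pi>) (below (num 0) \<Sigma>')"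
  define elem where "elem i = (map_pure Tm (\<Pi>s i), map (map_atom Tm) (\<Sigma>s i))" for i
  define S where "S = map elem (sorted_list_of_set I)"
  define \<psi> where "\<psi> = transl \<nu> X \<Pi>0 \<Sigma>' S"
  define body where "body i = FAnd (Pure (\<Pi>s i)) (tilde (\<Sigma>s i))" for i
  let ?Y = "set y"
  have \<phi>_elim: "\<phi> = elim \<psi>"
    by (simp add: \<phi> P_def \<psi>_def \<Pi>0_def \<Sigma>'_def S_def elem_def[abs_def] comp_def Let_def)
  have set_S: "set S = elem ` I"
    using \<open>finite I\<close> by (simp add: S_def)
  have set_y: "?Y = (\<Union>i\<in>I. set (ys i))"
    using \<open>finite I\<close> by (simp add: y)
  have fv_rhs: "fv rhs = (\<Union>i\<in>I. fv (body i) - set (ys i))"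
    using \<open>finite I\<close> by (simp add: rhs fv_FDisj fv_foldr_FEx body_def)
  have "?Y \<subseteq> X"
    using X by blast
  \<comment> \<open>Variables of \<open>y\<close> are not free in the left-hand side, which gives
    the initial constancy required by \<open>left_ok\<close>.\<close>
  have fv_left: "fv_pure (map_pure Tm \<Pi>) \<union> fv_spatial \<Sigma>' \<subseteq> X - ?Y"
    using bound_vars X(2) by (auto simp: V lhs tilde_def \<Sigma>'_def fv_spatial_map_Tm fv_map_Tm)
  then have fv_\<Pi>0: "fv_pure \<Pi>0 \<subseteq> X - ?Y"
    using fv_below[of "num 0" \<Sigma>'] by (auto simp: \<Pi>0_def)
  have elems: "\<forall>e\<in>set S. elem_ok X ?Y s e" for s
  proof
    fix e assume "e \<in> set S"
    then obtain i where i: "i \<in> I" and e: "e = elem i"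
      by (auto simp: set_S)
    have "fv_pure (\<Pi>s i) \<subseteq> X" and fv_\<Sigma>: "fv_spatial (\<Sigma>s i) \<subseteq> X"
      using X(2) i by (auto simp: V)
    moreover have "arr_ok X ?Y s a b" if ab: "Arr a b \<in> set (map (map_atom Tm) (\<Sigma>s i))" for a b
    proof -
      obtain c where "c \<in> set (\<Sigma>s i)" "Arr a b = map_atom Tm c"
        using ab by auto
      then obtain t t' where t: "Arr t t' \<in> set (\<Sigma>s i)" "a = Tm t" "b = Tm t'"
        by - (cases c; auto)
      then obtain u where u: "t' = Add t u" "vars u \<inter> ?Y = {}"
        using arrays[OF i] by blast
      have "vars t' \<subseteq> fv_spatial (\<Sigma>s i)"
        using t(1) by (force simp: fv_spatial_def)
      with u fv_\<Sigma> have "vars u \<subseteq> X - ?Y"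
        by auto
      \<comment> \<open>The difference of the end points is the value of \<open>u\<close>, which
        contains no variable of \<open>y\<close>.\<close>
      have "ival s' b - ival s' a = ival s b - ival s a" if s': "agree (X - ?Y) s s'" for s'
        using val_agree[OF agree_mono[OF s' \<open>vars u \<subseteq> X - ?Y\<close>]] by (simp add: t u)
      moreover have "ival s a \<le> ival s b"
        by (simp add: t u)
      ultimately show ?thesis
        unfolding arr_ok_def by blast
    qed
    ultimately show "elem_ok X ?Y s e"
      by (simp add: e elem_def elem_ok_def fv_map_Tm fv_spatial_map_Tm del: set_map)
  qed
  have sat_lhs: "sat s h lhs \<longleftrightarrow> psat s \<Pi>0 \<and> ssat (lift h) (ev s \<Sigma>')" for s h
    by (auto simp: lhs sat_tilde \<Pi>0_def psat_map_Tm \<Sigma>'_def ev_map_Tm simp del: map_map)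
  have sat_rhs: "sat s h rhs \<longleftrightarrow> covered X ?Y s S (lift h)" if "is_heap h" for s h
  proof -
    have body: "sat s' h (body i) \<longleftrightarrow> esat s' (lift h) (elem i)" for s' i
      using sat_tilde_heap[OF that, of s' "\<Sigma>s i"]
      by (simp add: body_def esat_def elem_def psat_map_Tm ev_map_Tm del: map_map)
    \<comment> \<open>Each disjunct binds its own \<open>ys i\<close>, whereas coverage varies all
      of \<open>y\<close> at once. The two agree because a variable of \<open>y\<close> free in
      \<open>body i\<close> must belong to \<open>ys i\<close>, by
      \<open>bound_vars\<close>.\<close>
    have "(\<exists>s'. agree (- set (ys i)) s s' \<and> sat s' h (body i)) \<longleftrightarrow>
        (\<exists>s'. agree (- ?Y) s s' \<and> sat s' h (body i))" if i: "i \<in> I" for i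
    proof
      assume "\<exists>s'. agree (- set (ys i)) s s' \<and> sat s' h (body i)"
      moreover have "- ?Y \<subseteq> - set (ys i)"
        using i set_y by blast
      ultimately show "\<exists>s'. agree (- ?Y) s s' \<and> sat s' h (body i)"
        using agree_mono by blast
    next
      assume "\<exists>s'. agree (- ?Y) s s' \<and> sat s' h (body i)"
      then obtain s' where s': "agree (- ?Y) s s'" "sat s' h (body i)"
        by blast
      define s'' where "s'' x = (if x \<in> set (ys i) then s' x else s x)" for x
      have "s'' x = s' x" if "x \<in> fv (body i)" for x
      proof (cases "x \<in> set (ys i)")
        case False
        with that i bound_vars have "x \<notin> ?Y"
          unfolding fv_rhs by blast
        with s'(1) False show ?thesis
          by (simp add: agree_def s''_def)
      qed (simp add: s''_def)
      then have "sat s'' h (body i)"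
        using s'(2) sat_agree[of "body i" s'' s' h] by (simp add: agree_def)
      moreover have "agree (- set (ys i)) s s''"
        by (simp add: agree_def s''_def)
      ultimately show "\<exists>s'. agree (- set (ys i)) s s' \<and> sat s' h (body i)"
        by blast
    qed
    then have "sat s h rhs \<longleftrightarrow> (\<exists>i\<in>I. \<exists>s'. agree (- ?Y) s s' \<and> sat s' h (body i))"
      using \<open>finite I\<close> by (simp add: rhs sat_FDisj sat_foldr_FEx flip: body_def)
    also have "\<dots> \<longleftrightarrow> covered X ?Y s S (lift h)"
      unfolding covered_off_Y[OF elems agree_refl] body set_S by blast
    finally show ?thesis .
  qed
  \<comment> \<open>Entailment speaks of genuine heaps, \<open>entails_at\<close> of integer heaps;
    the conjunct \<open>0 < \<Sigma>\<close> in \<open>\<Pi>0\<close> ensures that the latter are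
    all lifted from the former.\<close>
  have "lhs \<TTurnstile> rhs \<longleftrightarrow> (\<forall>s. psat s \<Pi>0 \<longrightarrow> entails_at X ?Y s (ev s \<Sigma>') S)"
  proof (intro iffI allI impI)
    fix s H assume "lhs \<TTurnstile> rhs" "psat s \<Pi>0" and H: "ssat H (ev s \<Sigma>')"
    then have "lt_head 0 (ev s \<Sigma>')"
      by (simp add: \<Pi>0_def)
    with H obtain h where "is_heap h" "lift h = H"
      by (rule ssat_is_lift)
    with \<open>lhs \<TTurnstile> rhs\<close> \<open>psat s \<Pi>0\<close> H show "covered X ?Y s S H"
      using sat_lhs sat_rhs unfolding entails_def by blast
  next
    assume "\<forall>s. psat s \<Pi>0 \<longrightarrow> entails_at X ?Y s (ev s \<Sigma>') S"
    then show "lhs \<TTurnstile> rhs"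
      using sat_lhs sat_rhs unfolding entails_def by blast
  qed
  also have "\<dots> \<longleftrightarrow> (\<forall>s. valid_at X ?Y s \<psi>)"
  proof (rule all_cong1)
    fix s
    have const: "psat s' \<Pi>0 \<longleftrightarrow> psat s \<Pi>0" "ev s' \<Sigma>' = ev s \<Sigma>'" if "agree (X - ?Y) s s'" for s'
      using agree_mono[OF that] fv_\<Pi>0 fv_left
      by (simp_all add: psat_agree[of \<Pi>0 s s'] ev_agree[of \<Sigma>' s s'])
    show "(psat s \<Pi>0 \<longrightarrow> entails_at X ?Y s (ev s \<Sigma>') S) \<longleftrightarrow> valid_at X ?Y s \<psi>"
    proof (cases "psat s \<Pi>0")
      case True
      have "left_ok X ?Y s \<Pi>0 \<Sigma>'"
      proof (rule left_okI)
        show "lt_head 0 (ev s \<Sigma>')"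
          using True by (simp add: \<Pi>0_def)
        show "conts_ok (ev s \<Sigma>')"
        proof (intro allI impI)
          fix a v assume "PointsTo a v \<in> set (ev s \<Sigma>')"
          then obtain c where "c \<in> set \<Sigma>" "PointsTo a v = map_atom (\<lambda>t. int (val s t)) c"
            unfolding \<Sigma>'_def ev_map_Tm by auto
          then show "0 \<le> v" by - (cases c; auto)
        qed
      qed (use fv_left const True in blast)+
      from transl_correct[OF computes_transl fresh X(1) \<open>?Y \<subseteq> X\<close> this elems] True
      show ?thesis
        unfolding \<psi>_def by blast
    next
      case False
      have "valid_at X ?Y s \<psi>"
        unfolding \<psi>_def by (rule valid_at_guard_false[OF computes_transl]) (use const False in blast)
      with False show ?thesis by simp
    qed
  qed
  \<comment> \<open>Once \<open>s\<close> ranges over all stores, the variation outside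
    \<open>X\<close> inside \<open>valid_at\<close> adds nothing: every \<open>s1\<close> is itself
    such a store.\<close>
  also have "\<dots> \<longleftrightarrow> (\<forall>s. \<exists>s2. agree (- ?Y) s s2 \<and> psat s2 \<psi>)"
    unfolding valid_at_def using agree_refl by blast
  also have "\<dots> \<longleftrightarrow> valid (Pure (foldr PAll zs (foldr PEx y \<phi>)))"
    by (simp add: valid_Pure sat_foldr_PAll sat_foldr_PEx \<phi>_elim sat_pure_elim)
  finally show ?thesis .
qed

end
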